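(* Fix $\rho\in(0,1]$ and let $\nu=\nu(\rho)=\frac{1}{\rho^2}-1$. Let $\mathrm{Star}_k$ be the star graph on $k+1$ vertices and let $S_k$ be the set of its $k$ leaves. Then, as $k\to\infty$, $$\mathcal{M}(\mathrm{Star}_k,\rho,S_k)=\tilde\Theta\left(k^{-\nu}\right),$$ i.e. there is a function $\eta(k)\ge 0$ (depending on $\rho$) with $\eta(k)\to0$ as $k\to\infty$ such that $k^{-\nu-\eta(k)}\le\mathcal{M}(\mathrm{Star}_k,\rho,S_k)\le k^{-\nu+\eta(k)}$ for all sufficiently large $k$. Moreover the lower bound is achieved asymptotically by the majority function with $n$ sufficiently large: $\eta$ can be chosen so that for all sufficiently large $k$ there is $n_0(k)$ such that for every odd $n\ge n_0(k)$, $\mathcal{P}(\mathrm{Star}_k,\rho,n,S_k,\mathrm{MAJ}_n)\ge k^{-\nu-\eta(k)}$.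
   Context: NICD on trees. An instance consists of a finite undirected tree $T$, a correlation parameter $\rho$ (in $(0,1)$, with $\rho=1$ meaning noiseless edges), an integer $n\ge1$ and a set of players $S\subseteq V(T)$. Random strings $x^{(v)}\in\{-1,1\}^n$, $v\in V(T)$, are generated as follows: the $n$ coordinates are independent, and for each coordinate $i$ the vector $\alpha=(x^{(v)}_i)_{v\in V(T)}\in\{-1,1\}^{V(T)}$ has probability $\mathbf{P}(\alpha)=\frac12(\frac12+\frac12\rho)^{A(\alpha)}(\frac12-\frac12\rho)^{B(\alpha)}$, where $A(\alpha)$, $B(\alpha)$ are the numbers of edges of $T$ whose endpoints agree, respectively disagree, in $\alpha$ (convention $0^0=1$). A function $f:\{-1,1\}^n\to\{-1,1\}$ is balanced if it takes each value on exactly $2^{n-1}$ inputs. A protocol is a family $(f_v)_{v\in S}$ of balanced functions; it is simple if all $f_v$ are the same function. $\mathcal{P}(T,\rho,n,S,(f_v)_{v\in S})$ is the probability that all the bits $f_v(x^{(v)})$, $v\in S$, are equal; for a simple protocol with common function $f$ write $\mathcal{P}(T,\rho,n,S,f)$. Define $\mathcal{M}(T,\rho,n,S)=\sup_{(f_v)}\mathcal{P}(T,\rho,n,S,(f_v))$ over all protocols, and $\mathcal{M}(T,\rho,S)=\sup_{n}\mathcal{M}(T,\rho,n,S)$. For odd $n$, $\mathrm{MAJ}_n(x)$ is the sign of $\sum_{i=1}^n x_i$. *)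

theory Defs
  imports Complex_Main "HOL-Library.FuncSet"
begin

section \<open>Undirected graphs, trees and stars\<close>

record 'v ugraph =
  vertices :: "'v set"
  edges :: "'v set set"

definition is_ugraph :: "'v ugraph \<Rightarrow> bool" where
  "is_ugraph T \<longleftrightarrow> finite (vertices T) \<and>
     (\<forall>e\<in>edges T. e \<subseteq> vertices T \<and> card e = 2)"

definition ugraph_connected :: "'v ugraph \<Rightarrow> bool" where
  "ugraph_connected T \<longleftrightarrow> vertices T \<noteq> {} \<and>
     (\<forall>u\<in>vertices T. \<forall>v\<in>vertices T. (u, v) \<in> {(a, b). {a, b} \<in> edges T}\<^sup>*)"

definition is_cycle :: "'v ugraph \<Rightarrow> 'v list \<Rightarrow> bool" where
  "is_cycle T vs \<longleftrightarrow> length vs \<ge> 3 \<and> distinct vs \<and>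
     (\<forall>i<length vs. {vs ! i, vs ! (Suc i mod length vs)} \<in> edges T)"

definition is_tree :: "'v ugraph \<Rightarrow> bool" where
  "is_tree T \<longleftrightarrow> is_ugraph T \<and> ugraph_connected T \<and> \<not> (\<exists>vs. is_cycle T vs)"

text \<open>The centre is \<open>0\<close> and the leaves are \<open>1, \<dots>, k\<close>.\<close>

definition Star :: "nat \<Rightarrow> nat ugraph" where
  "Star k = \<lparr>vertices = {0..k}, edges = (\<lambda>j. {0, j}) ` {1..k}\<rparr>"

definition star_leaves :: "nat \<Rightarrow> nat set" where
  "star_leaves k = {1..k}"


section \<open>The random strings\<close>

text \<open>
  A string is a function on the coordinates \<open>{..<n}\<close> that is extensional
  (equal to \<open>undefined\<close> elsewhere), so that \<open>cube n\<close> has exactly \<open>2 ^ n\<close> elements.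
\<close>

definition cube :: "nat \<Rightarrow> (nat \<Rightarrow> int) set" where
  "cube n = {..<n} \<rightarrow>\<^sub>E {-1, 1}"

definition agree_edges :: "'v ugraph \<Rightarrow> ('v \<Rightarrow> int) \<Rightarrow> nat" where
  "agree_edges T \<alpha> = card {e \<in> edges T. \<forall>u\<in>e. \<forall>v\<in>e. \<alpha> u = \<alpha> v}"

definition disagree_edges :: "'v ugraph \<Rightarrow> ('v \<Rightarrow> int) \<Rightarrow> nat" where
  "disagree_edges T \<alpha> = card {e \<in> edges T. \<exists>u\<in>e. \<exists>v\<in>e. \<alpha> u \<noteq> \<alpha> v}"

definition coord_prob :: "'v ugraph \<Rightarrow> real \<Rightarrow> ('v \<Rightarrow> int) \<Rightarrow> real" where
  "coord_prob T \<rho> \<alpha> =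
     1/2 * (1/2 + 1/2 * \<rho>) ^ agree_edges T \<alpha> * (1/2 - 1/2 * \<rho>) ^ disagree_edges T \<alpha>"

text \<open>
  The probability that the family of strings \<open>(x v)\<close>, \<open>v\<close> a vertex, takes a given value:
  the coordinates are independent, each with law \<open>coord_prob\<close>.
\<close>

definition strings_prob :: "'v ugraph \<Rightarrow> real \<Rightarrow> nat \<Rightarrow> ('v \<Rightarrow> nat \<Rightarrow> int) \<Rightarrow> real" where
  "strings_prob T \<rho> n x = (\<Prod>i<n. coord_prob T \<rho> (\<lambda>v. x v i))"


section \<open>Protocols and their success probability\<close>

definition balanced :: "nat \<Rightarrow> ((nat \<Rightarrow> int) \<Rightarrow> int) \<Rightarrow> bool" where
  "balanced n f \<longleftrightarrow> f \<in> cube n \<rightarrow> {-1, 1} \<and>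
     card {x \<in> cube n. f x = 1} = 2 ^ (n - 1) \<and>
     card {x \<in> cube n. f x = -1} = 2 ^ (n - 1)"

definition protocols :: "nat \<Rightarrow> 'v set \<Rightarrow> ('v \<Rightarrow> (nat \<Rightarrow> int) \<Rightarrow> int) set" where
  "protocols n S = {f. \<forall>v\<in>S. balanced n (f v)}"

definition success_prob ::
    "'v ugraph \<Rightarrow> real \<Rightarrow> nat \<Rightarrow> 'v set \<Rightarrow> ('v \<Rightarrow> (nat \<Rightarrow> int) \<Rightarrow> int) \<Rightarrow> real" where
  "success_prob T \<rho> n S f =
     (\<Sum>x \<in> {x \<in> vertices T \<rightarrow>\<^sub>E cube n. \<forall>u\<in>S. \<forall>v\<in>S. f u (x u) = f v (x v)}.
        strings_prob T \<rho> n x)"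

definition simple_success_prob ::
    "'v ugraph \<Rightarrow> real \<Rightarrow> nat \<Rightarrow> 'v set \<Rightarrow> ((nat \<Rightarrow> int) \<Rightarrow> int) \<Rightarrow> real" where
  "simple_success_prob T \<rho> n S f = success_prob T \<rho> n S (\<lambda>_. f)"

text \<open>
  Both suprema are taken in the conditionally complete order of the reals; the lemmas at
  the end of this theory show that, for stars, they are over nonempty sets bounded by \<open>1\<close>.
\<close>

definition max_success_n :: "'v ugraph \<Rightarrow> real \<Rightarrow> nat \<Rightarrow> 'v set \<Rightarrow> real" where
  "max_success_n T \<rho> n S = (SUP f \<in> protocols n S. success_prob T \<rho> n S f)"

definition max_success :: "'v ugraph \<Rightarrow> real \<Rightarrow> 'v set \<Rightarrow> real" where
  "max_success T \<rho> S = (SUP n \<in> {1..}. max_success_n T \<rho> n S)"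

definition MAJ :: "nat \<Rightarrow> (nat \<Rightarrow> int) \<Rightarrow> int" where
  "MAJ n x = sgn (\<Sum>i<n. x i)"

definition star_exponent :: "real \<Rightarrow> real" where
  "star_exponent \<rho> = 1 / \<rho>\<^sup>2 - 1"


section \<open>Well-formedness of the model on stars\<close>

lemma is_tree_Star: "is_tree (Star k)"
proof -
  let ?R = "{(a, b). {a, b} \<in> edges (Star k)}"
  have toc: "(u, 0) \<in> ?R\<^sup>*" and fromc: "(0, u) \<in> ?R\<^sup>*" if "u \<in> vertices (Star k)" for u
  proof -
    have "u = 0 \<or> {0, u} \<in> edges (Star k)" using that by (auto simp: Star_def)
    then show "(u, 0) \<in> ?R\<^sup>*" "(0, u) \<in> ?R\<^sup>*"
      by (auto simp: insert_commute)
  qed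
  have "ugraph_connected (Star k)"
    unfolding ugraph_connected_def using rtrancl_trans[OF toc fromc] by (auto simp: Star_def)
  moreover have "is_ugraph (Star k)"
    by (auto simp: is_ugraph_def Star_def card_insert_if)
  moreover have False if "is_cycle (Star k) vs" for vs
  proof -
    let ?m = "length vs"
    have m: "?m \<ge> 3" and d: "distinct vs"
      and e: "\<And>i. i < ?m \<Longrightarrow> {vs ! i, vs ! (Suc i mod ?m)} \<in> edges (Star k)"
      using that by (auto simp: is_cycle_def)
    have z: "vs ! i = 0 \<or> vs ! (Suc i mod ?m) = 0" if "i < ?m" for i
      using e[OF that] by (auto simp: Star_def doubleton_eq_iff)
    have u: "i = j" if "vs ! i = 0" "vs ! j = 0" "i < ?m" "j < ?m" for i j
      using d that by (simp add: nth_eq_iff_index_eq[symmetric])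
    have s: "Suc 0 mod ?m = 1" "Suc 1 mod ?m = 2" "2 < ?m" "vs \<noteq> []" using m by auto
    have s': "Suc 2 mod ?m < ?m" using m by (intro mod_less_divisor) linarith
    have "Suc 2 mod ?m \<noteq> 1" using m by (cases "?m = 3") auto
    then show False
      using z[of 0] z[of 1] z[of 2] s s' u[of 0 1] u[of 0 2] u[of 1 2] u[of 1 "Suc 2 mod ?m"]
      by (auto simp: numeral_2_eq_2)
  qed
  ultimately show ?thesis by (auto simp: is_tree_def)
qed

lemma coord_prob_Star:
  "coord_prob (Star k) \<rho> \<alpha> =
     1/2 * (\<Prod>j\<in>{1..k}. if \<alpha> j = \<alpha> 0 then 1/2 + 1/2 * \<rho> else 1/2 - 1/2 * \<rho>)"
proof -
  have inj: "inj_on (\<lambda>j::nat. {0, j}) A" for A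
    by (auto simp: inj_on_def doubleton_eq_iff)
  have im: "{e \<in> edges (Star k). P e} = (\<lambda>j. {0, j}) ` {j\<in>{1..k}. P {0, j}}" for P
    unfolding Star_def by auto
  have "(\<forall>u\<in>{0, j}. \<forall>v\<in>{0, j}. \<alpha> u = \<alpha> v) \<longleftrightarrow> \<alpha> j = \<alpha> 0"
    and "(\<exists>u\<in>{0, j}. \<exists>v\<in>{0, j}. \<alpha> u \<noteq> \<alpha> v) \<longleftrightarrow> \<alpha> j \<noteq> \<alpha> 0" for j
    by (simp only: ball_simps bex_simps; metis)+
  then have a: "agree_edges (Star k) \<alpha> = card {j\<in>{1..k}. \<alpha> j = \<alpha> 0}"
    and b: "disagree_edges (Star k) \<alpha> = card {j\<in>{1..k}. \<alpha> j \<noteq> \<alpha> 0}"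
    by (simp_all only: agree_edges_def disagree_edges_def im card_image[OF inj])
  have "{1..k} \<inter> {j. \<alpha> j = \<alpha> 0} = {j\<in>{1..k}. \<alpha> j = \<alpha> 0}"
    and "{1..k} \<inter> - {j. \<alpha> j = \<alpha> 0} = {j\<in>{1..k}. \<alpha> j \<noteq> \<alpha> 0}" by blast+
  then show ?thesis
    unfolding coord_prob_def a b
    by (subst prod.If_cases) (simp_all only: finite_atLeastAtMost prod_constant mult.assoc)
qed

lemma sum_coord_prob_Star:
  "(\<Sum>\<alpha> \<in> vertices (Star k) \<rightarrow>\<^sub>E {-1, 1}. coord_prob (Star k) \<rho> \<alpha>) = 1"
proof -
  let ?g = "\<lambda>(a::int) (b::int). if b = a then 1/2 + 1/2 * \<rho> else 1/2 - 1/2 * \<rho>"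
  have v: "vertices (Star k) = insert 0 {1..k}" by (auto simp: Star_def)
  have "(\<Sum>\<alpha> \<in> vertices (Star k) \<rightarrow>\<^sub>E {-1, 1}. coord_prob (Star k) \<rho> \<alpha>) =
      (\<Sum>(a, \<beta>) \<in> {-1, 1} \<times> ({1..k} \<rightarrow>\<^sub>E {-1, 1}). coord_prob (Star k) \<rho> (\<beta>(0 := a)))"
    unfolding v PiE_insert_eq
    using inj_combinator[of 0 "{1..k}" "\<lambda>_. {-1, 1::int}"]
    by (subst sum.reindex) (simp_all add: split_def)
  also have "\<dots> = (\<Sum>(a, \<beta>) \<in> {-1, 1} \<times> ({1..k} \<rightarrow>\<^sub>E {-1, 1}). 1/2 * (\<Prod>j\<in>{1..k}. ?g a (\<beta> j)))"
    by (intro sum.cong refl) (auto simp: coord_prob_Star intro!: prod.cong)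
  also have "\<dots> = (\<Sum>a\<in>{-1, 1}. 1/2 * (\<Sum>\<beta>\<in>{1..k} \<rightarrow>\<^sub>E {-1, 1}. \<Prod>j\<in>{1..k}. ?g a (\<beta> j)))"
    by (simp only: sum.cartesian_product[symmetric] sum_distrib_left)
  also have "\<dots> = (\<Sum>a\<in>{-1, 1}. 1/2 * (\<Prod>j\<in>{1..k}. \<Sum>b\<in>{-1, 1}. ?g a b))"
    by (subst prod_sum_PiE) auto
  also have "\<dots> = 1" by simp
  finally show ?thesis .
qed

lemma coord_prob_nonneg:
  assumes "0 \<le> \<rho>" "\<rho> \<le> 1"
  shows "coord_prob T \<rho> \<alpha> \<ge> 0"
  using assms by (simp add: coord_prob_def)

lemma sum_strings_prob_Star:
  "(\<Sum>x \<in> vertices (Star k) \<rightarrow>\<^sub>E cube n. strings_prob (Star k) \<rho> n x) = 1"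
proof -
  let ?V = "vertices (Star k)"
  have "(\<Sum>x \<in> ?V \<rightarrow>\<^sub>E cube n. strings_prob (Star k) \<rho> n x) =
      (\<Sum>y \<in> {..<n} \<rightarrow>\<^sub>E (?V \<rightarrow>\<^sub>E {-1, 1}). \<Prod>i<n. coord_prob (Star k) \<rho> (y i))"
  proof (rule sum.reindex_bij_witness
      [where i = "\<lambda>y. \<lambda>v\<in>?V. \<lambda>i\<in>{..<n}. y i v" and j = "\<lambda>x. \<lambda>i\<in>{..<n}. \<lambda>v\<in>?V. x v i"])
    fix x assume x: "x \<in> ?V \<rightarrow>\<^sub>E cube n"
    show "(\<lambda>v\<in>?V. \<lambda>i\<in>{..<n}. (\<lambda>i\<in>{..<n}. \<lambda>v\<in>?V. x v i) i v) = x"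
    proof
      fix v
      show "(\<lambda>v\<in>?V. \<lambda>i\<in>{..<n}. (\<lambda>i\<in>{..<n}. \<lambda>v\<in>?V. x v i) i v) v = x v"
      proof (cases "v \<in> ?V")
        case True
        then have "x v \<in> {..<n} \<rightarrow>\<^sub>E {-1, 1}" using x by (auto simp: cube_def)
        then show ?thesis using True
          by (auto simp: fun_eq_iff restrict_def PiE_def extensional_def)
      next
        case False
        then show ?thesis using x by (simp add: PiE_def extensional_def)
      qed
    qed
    show "(\<lambda>i\<in>{..<n}. \<lambda>v\<in>?V. x v i) \<in> {..<n} \<rightarrow>\<^sub>E (?V \<rightarrow>\<^sub>E {-1, 1})"
    proof (intro restrict_PiE_iff[THEN iffD2] ballI)
      fix i v assume "i \<in> {..<n}" "v \<in> ?V"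
      then show "x v i \<in> {-1, 1}" using x unfolding cube_def by (meson PiE_mem)
    qed
    show "(\<Prod>i<n. coord_prob (Star k) \<rho> ((\<lambda>i\<in>{..<n}. \<lambda>v\<in>?V. x v i) i)) =
        strings_prob (Star k) \<rho> n x"
      unfolding strings_prob_def coord_prob_Star
      by (intro prod.cong refl arg_cong2[where f = "(*)"]) (auto simp: Star_def)
  next
    fix y assume y: "y \<in> {..<n} \<rightarrow>\<^sub>E (?V \<rightarrow>\<^sub>E {-1, 1::int})"
    show "(\<lambda>i\<in>{..<n}. \<lambda>v\<in>?V. (\<lambda>v\<in>?V. \<lambda>i\<in>{..<n}. y i v) v i) = y"
    proof
      fix i
      show "(\<lambda>i\<in>{..<n}. \<lambda>v\<in>?V. (\<lambda>v\<in>?V. \<lambda>i\<in>{..<n}. y i v) v i) i = y i"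
      proof (cases "i < n")
        case True
        then have "y i \<in> ?V \<rightarrow>\<^sub>E {-1, 1}" using y by auto
        then show ?thesis using True
          by (auto simp: fun_eq_iff restrict_def PiE_def extensional_def)
      next
        case False
        then show ?thesis using y by (simp add: PiE_def extensional_def)
      qed
    qed
    show "(\<lambda>v\<in>?V. \<lambda>i\<in>{..<n}. y i v) \<in> ?V \<rightarrow>\<^sub>E cube n"
      unfolding cube_def
    proof (intro restrict_PiE_iff[THEN iffD2] ballI)
      fix i v assume "i \<in> {..<n}" "v \<in> ?V"
      then show "y i v \<in> {-1, 1}" using y by (meson PiE_mem)
    qed
  qed
  also have "\<dots> = (\<Prod>i<n. \<Sum>\<alpha> \<in> ?V \<rightarrow>\<^sub>E {-1, 1}. coord_prob (Star k) \<rho> \<alpha>)"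
    by (rule prod_sum_PiE[symmetric]) (auto simp: Star_def intro!: finite_PiE)
  also have "\<dots> = 1" by (simp add: sum_coord_prob_Star)
  finally show ?thesis .
qed

lemma success_prob_Star_bounds:
  assumes "0 \<le> \<rho>" "\<rho> \<le> 1"
  shows "0 \<le> success_prob (Star k) \<rho> n S f" "success_prob (Star k) \<rho> n S f \<le> 1"
proof -
  have nn: "strings_prob (Star k) \<rho> n x \<ge> 0" for x
    unfolding strings_prob_def using coord_prob_nonneg[OF assms] by (intro prod_nonneg) auto
  show "0 \<le> success_prob (Star k) \<rho> n S f"
    unfolding success_prob_def using nn by (intro sum_nonneg) auto
  have fin: "finite (vertices (Star k) \<rightarrow>\<^sub>E cube n)"
    by (intro finite_PiE) (simp_all add: Star_def cube_def finite_PiE)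
  have "success_prob (Star k) \<rho> n S f \<le>
      (\<Sum>x \<in> vertices (Star k) \<rightarrow>\<^sub>E cube n. strings_prob (Star k) \<rho> n x)"
    unfolding success_prob_def using nn
    by (intro sum_mono2 fin) blast+
  then show "success_prob (Star k) \<rho> n S f \<le> 1" by (simp add: sum_strings_prob_Star)
qed

lemma protocols_nonempty:
  assumes "n \<ge> 1"
  shows "protocols n S \<noteq> {}"
proof -
  have *: "card {x \<in> cube n. x 0 = c} = 2 ^ (n - 1)" if c: "c \<in> {-1, 1}" for c
  proof -
    let ?B = "\<lambda>i::nat. if i = 0 then {c} else {-1, 1::int}"
    have "{x \<in> cube n. x 0 = c} = PiE {..<n} ?B"
    proof (rule set_eqI)
      fix x :: "nat \<Rightarrow> int"
      have "(x \<in> extensional {..<n} \<and> (\<forall>i\<in>{..<n}. x i \<in> {-1, 1}) \<and> x 0 = c) \<longleftrightarrow>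
          (x \<in> extensional {..<n} \<and> (\<forall>i\<in>{..<n}. x i \<in> ?B i))"
        (is "?l \<longleftrightarrow> ?r")
      proof
        assume ?l then show ?r by simp
      next
        assume r: ?r
        have "x i \<in> ?B i" if "i < n" for i using r that by blast
        moreover from this[of 0] have "x 0 = c" using assms by simp
        ultimately show ?l using r c by (metis lessThan_iff singletonD)
      qed
      then show "x \<in> {x \<in> cube n. x 0 = c} \<longleftrightarrow> x \<in> PiE {..<n} ?B"
        by (simp only: cube_def PiE_iff mem_Collect_eq conj_ac)
    qed
    also have "card \<dots> = (\<Prod>i<n. card (?B i))"
      by (rule card_PiE) simp
    also have "\<dots> = (\<Prod>i\<in>insert 0 {1..<n}. card (?B i))"
      using assms by (intro prod.cong) auto
    also have "\<dots> = (\<Prod>i\<in>{1..<n}. 2)"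
      by (subst prod.insert) (auto simp: numeral_2_eq_2)
    finally show ?thesis by (simp only: prod_constant card_atLeastLessThan)
  qed
  have "balanced n (\<lambda>x. x 0)"
    using assms *[of 1] *[of "-1"] unfolding balanced_def by (auto simp: cube_def PiE_iff)
  then have "(\<lambda>_ x. x 0) \<in> protocols n S" by (simp add: protocols_def)
  then show ?thesis by blast
qed

lemma success_prob_Star_bdd:
  assumes "0 \<le> \<rho>" "\<rho> \<le> 1"
  shows "bdd_above (success_prob (Star k) \<rho> n S ` protocols n S)"
  using success_prob_Star_bounds(2)[OF assms] by (auto intro!: bdd_aboveI2[where M = 1])

lemma max_success_n_Star_bdd:
  assumes "0 \<le> \<rho>" "\<rho> \<le> 1"
  shows "bdd_above ((\<lambda>n. max_success_n (Star k) \<rho> n S) ` {1..})"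
  unfolding max_success_n_def
  by (intro bdd_aboveI2[where M = 1] cSUP_least protocols_nonempty
      success_prob_Star_bounds(2)[OF assms]) simp

end

theory Submission
  imports Defs "HOL-Analysis.Analysis" "HOL-Real_Asymp.Real_Asymp"
begin

text \<open>
  Condition on the string \<open>y\<close> of the centre. The leaves are then independent, and player \<open>v\<close>
  outputs \<open>1\<close> with probability \<open>hit_prob \<rho> n A y\<close>, the noise operator applied to the indicator
  of \<open>A = {x. f v x = 1}\<close>. All players output \<open>1\<close> with the \<open>y\<close>-average of the product of these
  probabilities, and likewise for \<open>-1\<close> (\<open>success_prob_Star_eq\<close>).

  Upper bound. By the inequality of arithmetic and geometric means, the product is at most the
  average of the \<open>k\<close>-th powers, so one bounds the mean of \<open>(1 - h y) ^ k\<close>, where \<open>h\<close> is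
  the probability of landing in a fixed set of density \<open>1/2\<close>. As
  \<open>(1 - h) ^ k \<le> exp (- k h)\<close> is at most a constant times \<open>(k h) powr (- a)\<close>, it suffices that
  the negative moment of order \<open>a\<close> of \<open>h\<close> is bounded independently of \<open>n\<close>, and this holds for
  every \<open>a < \<nu>\<close> (\<open>hit_prob_negative_moment\<close>). The moment bound is the reverse Bonami-Beckner
  inequality: for \<open>0 < p, q < 1\<close> with \<open>(1 - p) (1 - q) = \<rho>\<^sup>2\<close> and \<open>\<rho>\<close>-correlated \<open>x, y\<close>, the mean
  of \<open>f x * g y\<close> is at least the \<open>p\<close>-norm of \<open>f\<close> times the \<open>q\<close>-norm of \<open>g\<close>. One takes
  the indicator of the set for \<open>f\<close> and a negative power of \<open>h\<close> for \<open>g\<close>. In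
  this two-function form the inequality passes from one coordinate to \<open>n\<close> coordinates by induction,
  and on one coordinate it reduces to \<open>cosh (q t) powr (2 / q) \<le> 1 + q (sinh t)\<^sup>2\<close>. The exponent
  \<open>\<nu> = 1/\<rho>\<^sup>2 - 1\<close> appears as the limit of \<open>a = q / (1 - q)\<close> when \<open>p \<rightarrow> 0\<close>.

  Lower bound. Suppose that the centre has \<open>\<Sum>y \<ge> t \<surd>n\<close>. Given \<open>y\<close>, a leaf sum has mean \<open>\<rho> \<Sum>y\<close> and
  variance \<open>(1 - \<rho>\<^sup>2) n\<close>, so by a Chernoff bound it is nonpositive with probability about
  \<open>exp (- \<rho>\<^sup>2 t\<^sup>2 / (2 (1 - \<rho>\<^sup>2)))\<close> at most. Choose \<open>t\<close> so that this is \<open>1/k\<close>: then all \<open>k\<close>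
  majorities are \<open>1\<close> with probability at least about \<open>1/e\<close>. The centre itself has such a
  deviation with probability about \<open>exp (- t\<^sup>2 / 2) = k powr (- \<nu>)\<close>, up to a factor
  \<open>exp (O (sqrt (ln k)))\<close>, by an exponential change of measure.
  Replacing \<open>(1 - \<rho>\<^sup>2) / 2\<close> by a slightly larger \<open>c\<close> covers the case \<open>\<rho> = 1\<close> as well.

  Both bounds are proved with an error \<open>\<epsilon>\<close> in the exponent, for each fixed \<open>\<epsilon>\<close> and all large
  \<open>k\<close>; a diagonal choice of \<open>\<epsilon>\<close> depending on \<open>k\<close> gives the error function \<open>\<eta>\<close>.
\<close>

section \<open>Two-point inequalities\<close>

text \<open>
  The quotient \<open>sinh x / x\<close> is nondecreasing for \<open>x > 0\<close>; here it is compared at \<open>a t\<close> and \<open>b t\<close>.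
\<close>

lemma sinh_chord:
  fixes a b t :: real
  assumes "0 < a" "a \<le> b" "t \<ge> 0"
  shows "b * sinh (a * t) \<le> a * sinh (b * t)"
proof -
  let ?f = "\<lambda>t. a * sinh (b * t) - b * sinh (a * t)"
  have "?f 0 \<le> ?f t"
  proof (rule DERIV_nonneg_imp_nondecreasing[OF assms(3)])
    fix x :: real assume x: "0 \<le> x" "x \<le> t"
    have "(?f has_real_derivative a * b * (cosh (b * x) - cosh (a * x))) (at x)"
      by (auto intro!: derivative_eq_intros simp: algebra_simps)
    moreover have "a * x \<le> b * x" using assms x by (intro mult_right_mono) auto
    then have "cosh (a * x) \<le> cosh (b * x)"
      using assms x by (simp add: cosh_real_nonneg_le_iff)
    ultimately show "\<exists>y. (?f has_real_derivative y) (at x) \<and> 0 \<le> y"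
      using assms by (intro exI[of _ "a * b * (cosh (b * x) - cosh (a * x))"] conjI) auto
  qed
  then show ?thesis by simp
qed

text \<open>
  The analytic core of the reverse Bonami-Beckner inequality. The logarithm of the ratio of the right-hand
  side to the left-hand side is even and vanishes at \<open>0\<close>; after clearing denominators, its derivative is nonnegative
  for \<open>t \<ge> 0\<close> because \<open>(2 - q) sinh (q t) \<le> q sinh ((2 - q) t)\<close>.
\<close>

lemma cosh_powr_le:
  fixes q t :: real
  assumes q: "0 < q" "q < 1"
  shows "cosh (q * t) powr (2 / q) \<le> 1 + q * (sinh t)\<^sup>2"
proof -
  have pos: "1 + q * (sinh x)\<^sup>2 > 0" for x :: real
    using q by (simp add: add_pos_nonneg)
  have *: "cosh (q * t) powr (2 / q) \<le> 1 + q * (sinh t)\<^sup>2" if "t \<ge> 0" for t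
  proof -
    let ?f = "\<lambda>t. (q / 2) * ln (1 + q * (sinh t)\<^sup>2) - ln (cosh (q * t))"
    have "?f 0 \<le> ?f t"
    proof (rule DERIV_nonneg_imp_nondecreasing[OF that])
      fix x :: real assume x: "0 \<le> x" "x \<le> t"
      have "(?f has_real_derivative
          (q / 2) * ((q * (2 * sinh x * cosh x)) / (1 + q * (sinh x)\<^sup>2))
           - (q * sinh (q * x)) / cosh (q * x)) (at x)"
        using pos[of x]
        by (intro derivative_eq_intros refl | simp add: cosh_real_pos mult_ac)+
      moreover have "sinh (q * x) * (1 + q * (sinh x)\<^sup>2) \<le> q * (sinh x * cosh x) * cosh (q * x)"
      proof -
        have "(2 - q) * sinh (q * x) \<le> q * sinh ((2 - q) * x)"
          using q x by (intro sinh_chord) auto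
        also have "(2 - q) * x = 2 * x - q * x" by (simp add: algebra_simps)
        finally have "(2 - q) * sinh (q * x) \<le>
            q * (2 * sinh x * cosh x * cosh (q * x) - (2 * (sinh x)\<^sup>2 + 1) * sinh (q * x))"
          by (simp add: sinh_diff sinh_double cosh_double cosh_square_eq)
        then show ?thesis by (simp add: algebra_simps)
      qed
      then have "(q * sinh (q * x)) / cosh (q * x)
          \<le> (q / 2) * ((q * (2 * sinh x * cosh x)) / (1 + q * (sinh x)\<^sup>2))"
        using q pos[of x] by (simp add: divide_simps cosh_real_pos mult_ac)
      ultimately show "\<exists>y. (?f has_real_derivative y) (at x) \<and> 0 \<le> y"
        by (intro exI[of _ "_ - _"] conjI) auto
    qed
    then have "ln (cosh (q * t)) * (2 / q) \<le> ln (1 + q * (sinh t)\<^sup>2)"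
      using q by (simp add: field_simps)
    then have "exp (ln (cosh (q * t)) * (2 / q)) \<le> exp (ln (1 + q * (sinh t)\<^sup>2))"
      by simp
    then show ?thesis using pos[of t] cosh_real_pos[of "q * t"]
      by (simp add: powr_def mult.commute)
  qed
  show ?thesis
  proof (cases "t \<ge> 0")
    case False
    then show ?thesis using *[of "- t"] by simp
  qed (rule *)
qed

text \<open>
  The degenerate case of the next inequality, out of reach of its exponential parametrization:
  dividing by \<open>u\<^sup>2\<close>, it says \<open>4 powr (1 / q - 1) \<ge> 1 / q\<close>, which follows from
  \<open>1 + x \<le> exp x\<close> and \<open>ln 4 \<ge> 1\<close>.
\<close>

lemma two_point_zero:
  fixes q u :: real
  assumes q: "0 < q" "q < 1" and "0 \<le> u"
  shows "(u powr q / 2) powr (2 / q) \<le> q * u\<^sup>2 / 4"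
proof (cases "u = 0")
  case False
  then have u: "u > 0" using assms by simp
  have "exp (- 2 * ln 2 * (1 / q - 1)) \<le> q"
  proof -
    have "1 / q \<le> 1 + 1 * (1 / q - 1)" by simp
    also have "\<dots> \<le> 1 + (2 * ln 2) * (1 / q - 1)"
      using q ln2_ge_two_thirds by (intro add_left_mono mult_right_mono) (auto simp: field_simps)
    also have "\<dots> \<le> exp (2 * ln 2 * (1 / q - 1))" by (rule exp_ge_add_one_self)
    finally have "inverse (exp (2 * ln 2 * (1 / q - 1))) \<le> inverse (1 / q)"
      using q by (intro le_imp_inverse_le) auto
    then show ?thesis by (simp add: exp_minus)
  qed
  moreover have "(1 / 2) powr (2 / q) = exp (- 2 * ln 2 * (1 / q - 1)) / 4"
  proof -
    have "(1 / 2) powr (2 / q) = exp (- 2 * ln 2 * (1 / q - 1) - 2 * ln 2)"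
      using q by (simp add: powr_def ln_div field_simps)
    also have "\<dots> = exp (- 2 * ln 2 * (1 / q - 1)) / exp (2 * ln 2)" by (rule exp_diff)
    also have "exp (2 * ln 2) = (4::real)" using exp_double[of "ln 2 :: real"] by simp
    finally show ?thesis .
  qed
  moreover have "(u powr q / 2) powr (2 / q) = u\<^sup>2 * (1 / 2) powr (2 / q)"
  proof -
    have "(u powr q / 2) powr (2 / q) = (u powr q * (1/2)) powr (2 / q)" by simp
    also have "\<dots> = (u powr q) powr (2 / q) * (1/2) powr (2 / q)" by (rule powr_mult)
    also have "(u powr q) powr (2 / q) = u\<^sup>2" using q u by (simp add: powr_powr)
    finally show ?thesis .
  qed
  ultimately show ?thesis using u by (simp add: mult.commute)
qed (use q in simp)

text \<open>
  For \<open>r\<^sup>2 = 1 - q\<close> the right-hand side is the product of the two values \<open>((1 + r) u + (1 - r) v) / 2\<close> and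
  \<open>((1 - r) u + (1 + r) v) / 2\<close>. So this says that smoothing with correlation \<open>r\<close> makes the
  geometric mean of a function on two points at least its \<open>q\<close>-norm. By homogeneity
  one may take \<open>u = exp t\<close>, \<open>v = exp (- t)\<close>.
\<close>

lemma two_point_one_function:
  fixes q u v :: real
  assumes q: "0 < q" "q < 1" and "0 \<le> u" "0 \<le> v"
  shows "((u powr q + v powr q) / 2) powr (2 / q) \<le> (q * (u\<^sup>2 + v\<^sup>2) + (4 - 2 * q) * (u * v)) / 4"
proof -
  consider "u = 0" | "v = 0" | "u > 0" "v > 0" using assms by linarith
  then show ?thesis
  proof cases
    case 1
    then show ?thesis using two_point_zero[OF q, of v] assms by simp
  next
    case 2
    then show ?thesis using two_point_zero[OF q, of u] assms by simp
  next
    case 3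
    \<comment> \<open>Geometric mean and half the logarithmic ratio, so that \<open>u\<close> and \<open>v\<close> are \<open>m exp (\<plusminus>t)\<close>.\<close>
    define m t where "m = sqrt (u * v)" and "t = (ln u - ln v) / 2"
    have m: "m > 0" "m = exp ((ln u + ln v) / 2)"
      using 3 by (simp_all add: m_def powr_half_sqrt[symmetric] powr_def ln_mult)
    have uv: "u = m * exp t" "v = m * exp (- t)"
      unfolding m(2) t_def using 3 by (simp_all add: exp_add[symmetric] field_simps)
    have "(u powr q + v powr q) / 2 = m powr q * cosh (q * t)"
      unfolding uv using m(1)
      by (simp add: powr_mult exp_powr_real cosh_field_def distrib_left mult.commute)
    then have "((u powr q + v powr q) / 2) powr (2 / q) = m\<^sup>2 * cosh (q * t) powr (2 / q)"
      using q m(1) by (simp add: powr_mult powr_powr)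
    also have "\<dots> \<le> m\<^sup>2 * (1 + q * (sinh t)\<^sup>2)"
      by (intro mult_left_mono cosh_powr_le q) simp
    also have "\<dots> = (q * (u\<^sup>2 + v\<^sup>2) + (4 - 2 * q) * (u * v)) / 4 + m\<^sup>2 * (1 - exp t * exp (- t))"
      unfolding uv sinh_field_def by (simp add: field_simps power2_eq_square)
    also have "exp t * exp (- t) = 1" by (simp add: exp_minus)
    finally show ?thesis by simp
  qed
qed

text \<open>
  Factor the correlation as \<open>\<rho> = r s\<close> with \<open>r\<^sup>2 = 1 - p\<close> and \<open>s\<^sup>2 = 1 - q\<close>, and distribute the
  noise between the two functions. The right-hand side is then the mean of the product of the two smoothed
  functions, hence at least the product of their geometric means, to which the one-function
  inequality applies.
\<close>

lemma two_point_two_function: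
  fixes p q \<rho> u1 u2 v1 v2 :: real
  assumes p: "0 < p" "p < 1" and q: "0 < q" "q < 1"
    and \<rho>: "0 \<le> \<rho>" "(1 - p) * (1 - q) = \<rho>\<^sup>2"
    and nn: "0 \<le> u1" "0 \<le> u2" "0 \<le> v1" "0 \<le> v2"
  shows "((u1 powr p + u2 powr p) / 2) powr (1 / p) * ((v1 powr q + v2 powr q) / 2) powr (1 / q)
    \<le> ((1/2 + 1/2 * \<rho>) * (u1 * v1 + u2 * v2) + (1/2 - 1/2 * \<rho>) * (u1 * v2 + u2 * v1)) / 2"
proof -
  define r s where "r = sqrt (1 - p)" and "s = sqrt (1 - q)"
  have rs: "r\<^sup>2 = 1 - p" "s\<^sup>2 = 1 - q" "0 \<le> r" "r \<le> 1" "0 \<le> s" "s \<le> 1"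
    using p q by (auto simp: r_def s_def)
  have \<rho>_eq: "\<rho> = r * s"
    using \<rho> by (metis r_def s_def real_sqrt_mult real_sqrt_abs abs_of_nonneg)
  define A1 A2 where "A1 = ((1 + r) * u1 + (1 - r) * u2) / 2" and "A2 = ((1 - r) * u1 + (1 + r) * u2) / 2"
  define B1 B2 where "B1 = ((1 + s) * v1 + (1 - s) * v2) / 2" and "B2 = ((1 - s) * v1 + (1 + s) * v2) / 2"
  have AB: "0 \<le> A1" "0 \<le> A2" "0 \<le> B1" "0 \<le> B2"
    unfolding A1_def A2_def B1_def B2_def using nn rs by simp_all
  have one: "((a powr x + b powr x) / 2) powr (1 / x)
      \<le> sqrt ((((1 + c) * a + (1 - c) * b) / 2) * (((1 - c) * a + (1 + c) * b) / 2))"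
    if x: "0 < x" "x < 1" "c\<^sup>2 = 1 - x" and ab: "0 \<le> a" "0 \<le> b" for a b c x :: real
  proof -
    have "(((1 + c) * a + (1 - c) * b) / 2) * (((1 - c) * a + (1 + c) * b) / 2)
        = ((1 - c\<^sup>2) * (a\<^sup>2 + b\<^sup>2) + (2 + 2 * c\<^sup>2) * (a * b)) / 4"
      by (simp add: field_simps power2_eq_square)
    also have "\<dots> = (x * (a\<^sup>2 + b\<^sup>2) + (4 - 2 * x) * (a * b)) / 4"
      unfolding x(3) by simp
    also have "\<dots> \<ge> ((a powr x + b powr x) / 2) powr (2 / x)"
      using x ab by (intro two_point_one_function)
    finally have "sqrt (((a powr x + b powr x) / 2) powr (2 / x))
        \<le> sqrt ((((1 + c) * a + (1 - c) * b) / 2) * (((1 - c) * a + (1 + c) * b) / 2))"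
      by simp
    moreover have "sqrt (((a powr x + b powr x) / 2) powr (2 / x))
        = ((a powr x + b powr x) / 2) powr (1 / x)"
      by (subst powr_half_sqrt[symmetric]) (simp_all add: powr_powr)
    ultimately show ?thesis by simp
  qed
  have "((u1 powr p + u2 powr p) / 2) powr (1 / p) * ((v1 powr q + v2 powr q) / 2) powr (1 / q)
      \<le> sqrt (A1 * A2) * sqrt (B1 * B2)"
    unfolding A1_def A2_def B1_def B2_def using p q nn rs
    by (intro mult_mono one) auto
  also have "\<dots> = sqrt ((A1 * B1) * (A2 * B2))"
    by (simp add: real_sqrt_mult)
  also have "\<dots> \<le> (A1 * B1 + A2 * B2) / 2"
    using AB by (intro arith_geo_mean_sqrt) auto
  also have "\<dots> = ((1/2 + 1/2 * \<rho>) * (u1 * v1 + u2 * v2) + (1/2 - 1/2 * \<rho>) * (u1 * v2 + u2 * v1)) / 2"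
    unfolding A1_def A2_def B1_def B2_def \<rho>_eq
    by (simp add: algebra_simps add_divide_distrib diff_divide_distrib)
  finally show ?thesis .
qed

section \<open>The noise kernel on the cube\<close>

lemma finite_cube [simp]: "finite (cube n)"
  by (simp add: cube_def finite_PiE)

lemma cube_mem: "x \<in> cube n \<Longrightarrow> i < n \<Longrightarrow> x i = 1 \<or> x i = -1"
  unfolding cube_def by (auto dest: PiE_mem)

lemma cube_upd: "x \<in> cube n \<Longrightarrow> a \<in> {-1, 1} \<Longrightarrow> x(n := a) \<in> cube (Suc n)"
  unfolding cube_def lessThan_Suc PiE_insert_eq by (rule image_eqI[of _ _ "(a, x)"]) auto

lemma sum_cube_Suc:
  "sum F (cube (Suc n)) = (\<Sum>x\<in>cube n. F (x(n := 1)) + F (x(n := -1)))" for F :: "_ \<Rightarrow> real"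
proof -
  have "sum F (cube (Suc n)) = (\<Sum>(a, x) \<in> {-1, 1} \<times> cube n. F (x(n := a)))"
    unfolding cube_def lessThan_Suc PiE_insert_eq
    using inj_combinator[of n "{..<n}" "\<lambda>_. {-1, 1::int}"]
    by (subst sum.reindex) (simp_all add: split_def)
  also have "\<dots> = (\<Sum>a\<in>{-1, 1}. \<Sum>x\<in>cube n. F (x(n := a)))"
    by (simp add: sum.cartesian_product)
  finally show ?thesis by (simp add: sum.distrib add.commute)
qed

lemma sum_cube_prod:
  fixes F :: "nat \<Rightarrow> int \<Rightarrow> real"
  shows "(\<Sum>x\<in>cube n. \<Prod>i<n. F i (x i)) = (\<Prod>i<n. F i 1 + F i (-1))"
proof -
  have "(\<Sum>x\<in>cube n. \<Prod>i<n. F i (x i)) = (\<Prod>i<n. \<Sum>a\<in>{-1, 1}. F i a)"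
    unfolding cube_def by (rule prod_sum_PiE[symmetric]) auto
  then show ?thesis by (simp add: add.commute)
qed

text \<open>
  The probability that a \<open>\<rho>\<close>-correlated copy of \<open>y\<close> equals \<open>x\<close>; it is symmetric in \<open>x\<close> and \<open>y\<close>.
\<close>

definition flip_prob :: "real \<Rightarrow> nat \<Rightarrow> (nat \<Rightarrow> int) \<Rightarrow> (nat \<Rightarrow> int) \<Rightarrow> real" where
  "flip_prob \<rho> n x y = (\<Prod>i<n. if x i = y i then 1/2 + 1/2 * \<rho> else 1/2 - 1/2 * \<rho>)"

lemma flip_prob_Suc:
  "flip_prob \<rho> (Suc n) (x(n := a)) (y(n := b)) =
    flip_prob \<rho> n x y * (if a = b then 1/2 + 1/2 * \<rho> else 1/2 - 1/2 * \<rho>)"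
  unfolding flip_prob_def by (simp add: lessThan_Suc mult.commute)

lemma flip_prob_nonneg: "0 \<le> \<rho> \<Longrightarrow> \<rho> \<le> 1 \<Longrightarrow> 0 \<le> flip_prob \<rho> n x y"
  unfolding flip_prob_def by (intro prod_nonneg) auto

lemma flip_prob_pos: "0 \<le> \<rho> \<Longrightarrow> \<rho> < 1 \<Longrightarrow> 0 < flip_prob \<rho> n x y"
  unfolding flip_prob_def by (intro prod_pos) auto

lemma sum_flip_prob:
  assumes "y \<in> cube n"
  shows "(\<Sum>x\<in>cube n. flip_prob \<rho> n x y) = 1"
proof -
  have "y i \<in> {-1, 1}" if "i < n" for i
    using assms that unfolding cube_def by (meson PiE_mem lessThan_iff)
  then show ?thesis
    unfolding flip_prob_def
    by (subst sum_cube_prod[where F = "\<lambda>i a. if a = y i then 1/2 + 1/2 * \<rho> else 1/2 - 1/2 * \<rho>"])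
       (intro prod.neutral, fastforce)
qed

text \<open>
  This is the noise operator applied to the indicator function of \<open>B\<close>.
\<close>

definition hit_prob :: "real \<Rightarrow> nat \<Rightarrow> (nat \<Rightarrow> int) set \<Rightarrow> (nat \<Rightarrow> int) \<Rightarrow> real" where
  "hit_prob \<rho> n B y = (\<Sum>x\<in>cube n \<inter> B. flip_prob \<rho> n x y)"

lemma hit_prob_nonneg: "0 \<le> \<rho> \<Longrightarrow> \<rho> \<le> 1 \<Longrightarrow> 0 \<le> hit_prob \<rho> n B y"
  unfolding hit_prob_def by (intro sum_nonneg flip_prob_nonneg)

lemma hit_prob_compl:
  assumes "y \<in> cube n"
  shows "hit_prob \<rho> n (- B) y = 1 - hit_prob \<rho> n B y"
proof -
  have "hit_prob \<rho> n B y + hit_prob \<rho> n (- B) y = (\<Sum>x\<in>(cube n \<inter> B) \<union> (cube n \<inter> - B). flip_prob \<rho> n x y)"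
    unfolding hit_prob_def by (subst sum.union_disjoint) auto
  also have "(cube n \<inter> B) \<union> (cube n \<inter> - B) = cube n" by blast
  finally show ?thesis using sum_flip_prob[OF assms, of \<rho>] by simp
qed

section \<open>Reverse hypercontractivity and negative moments\<close>

text \<open>
  The two-function form makes the induction on \<open>n\<close> immediate: fixing the last coordinates
  \<open>a\<close> of \<open>x\<close> and \<open>b\<close> of \<open>y\<close>, the induction hypothesis bounds the mean over the other coordinates by
  \<open>F a * G b\<close>, where \<open>F\<close> and \<open>G\<close> are the partial norms; the two-point inequality for \<open>F\<close> and
  \<open>G\<close> then finishes, because the norm of a function is the norm of its partial norms.
\<close>

lemma reverse_hypercontractivity:
  fixes p q \<rho> :: real and f g :: "(nat \<Rightarrow> int) \<Rightarrow> real"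
  assumes p: "0 < p" "p < 1" and q: "0 < q" "q < 1"
    and \<rho>: "0 \<le> \<rho>" "(1 - p) * (1 - q) = \<rho>\<^sup>2"
    and "\<And>x. x \<in> cube n \<Longrightarrow> 0 \<le> f x" "\<And>x. x \<in> cube n \<Longrightarrow> 0 \<le> g x"
  shows "((1/2)^n * (\<Sum>x\<in>cube n. f x powr p)) powr (1 / p)
       * ((1/2)^n * (\<Sum>y\<in>cube n. g y powr q)) powr (1 / q)
    \<le> (1/2)^n * (\<Sum>x\<in>cube n. \<Sum>y\<in>cube n. flip_prob \<rho> n x y * f x * g y)"
  using assms(7,8)
proof (induction n arbitrary: f g)
  case 0
  have "cube 0 = {\<lambda>_. undefined}" by (simp add: cube_def)
  then show ?case using 0 p q by (simp add: powr_powr flip_prob_def)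
next
  case (Suc n)
  define F where "F a = ((1/2)^n * (\<Sum>x\<in>cube n. f (x(n := a)) powr p)) powr (1 / p)" for a
  define G where "G b = ((1/2)^n * (\<Sum>y\<in>cube n. g (y(n := b)) powr q)) powr (1 / q)" for b
  define I where "I a b = (1/2)^n * (\<Sum>x\<in>cube n. \<Sum>y\<in>cube n.
      flip_prob \<rho> n x y * f (x(n := a)) * g (y(n := b)))" for a b
  have IH: "F a * G b \<le> I a b" if "a \<in> {-1, 1}" "b \<in> {-1, 1}" for a b
    unfolding F_def G_def I_def using that
    by (intro Suc.IH Suc.prems cube_upd)
  have Fp: "F a powr p = (1/2)^n * (\<Sum>x\<in>cube n. f (x(n := a)) powr p)" for a
    using p by (simp add: F_def powr_powr sum_nonneg)
  have Gq: "G b powr q = (1/2)^n * (\<Sum>y\<in>cube n. g (y(n := b)) powr q)" for b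
    using q by (simp add: G_def powr_powr sum_nonneg)
  have f: "(1/2)^Suc n * (\<Sum>x\<in>cube (Suc n). f x powr p) = (F 1 powr p + F (-1) powr p) / 2"
    unfolding Fp sum_cube_Suc by (simp add: sum.distrib field_simps)
  have g: "(1/2)^Suc n * (\<Sum>y\<in>cube (Suc n). g y powr q) = (G 1 powr q + G (-1) powr q) / 2"
    unfolding Gq sum_cube_Suc by (simp add: sum.distrib field_simps)
  let ?c = "1/2 + 1/2 * \<rho>" and ?d = "1/2 - 1/2 * \<rho>"
  have d: "?d \<ge> 0"
  proof -
    have "(1 - p) * (1 - q) \<le> 1 * 1" using p q by (intro mult_mono) auto
    then have "\<rho>\<^sup>2 \<le> 1\<^sup>2" using \<rho> by simp
    then have "\<rho> \<le> 1" by (rule power2_le_imp_le) simp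
    then show ?thesis by simp
  qed
  have "((1/2)^Suc n * (\<Sum>x\<in>cube (Suc n). f x powr p)) powr (1 / p)
       * ((1/2)^Suc n * (\<Sum>y\<in>cube (Suc n). g y powr q)) powr (1 / q)
     \<le> (?c * (F 1 * G 1 + F (-1) * G (-1)) + ?d * (F 1 * G (-1) + F (-1) * G 1)) / 2"
    unfolding f g
    by (intro two_point_two_function p q \<rho>) (auto simp: F_def G_def)
  also have "\<dots> \<le> (?c * (I 1 1 + I (-1) (-1)) + ?d * (I 1 (-1) + I (-1) 1)) / 2"
    using d \<rho> by (intro divide_right_mono add_mono mult_left_mono IH) auto
  also have "\<dots> = (1/2)^Suc n * (\<Sum>x\<in>cube (Suc n). \<Sum>y\<in>cube (Suc n). flip_prob \<rho> (Suc n) x y * f x * g y)"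
  proof -
    have "(\<Sum>x\<in>cube (Suc n). \<Sum>y\<in>cube (Suc n). flip_prob \<rho> (Suc n) x y * f x * g y)
      = (\<Sum>x\<in>cube n. \<Sum>y\<in>cube n.
          ?c * (flip_prob \<rho> n x y * f (x(n := 1)) * g (y(n := 1)))
        + ?c * (flip_prob \<rho> n x y * f (x(n := -1)) * g (y(n := -1)))
        + ?d * (flip_prob \<rho> n x y * f (x(n := 1)) * g (y(n := -1)))
        + ?d * (flip_prob \<rho> n x y * f (x(n := -1)) * g (y(n := 1))))"
      unfolding sum_cube_Suc sum.distrib[symmetric]
      by (intro sum.cong refl) (simp add: flip_prob_Suc algebra_simps)
    also have "(1/2)^n * \<dots> = ?c * (I 1 1 + I (-1) (-1)) + ?d * (I 1 (-1) + I (-1) 1)"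
      unfolding sum.distrib I_def sum_distrib_left[symmetric] by (simp add: algebra_simps)
    finally show ?thesis by simp
  qed
  finally show ?case .
qed

text \<open>
  Write \<open>h\<close> for \<open>hit_prob \<rho> n B\<close> and \<open>N\<close> for the left-hand side. Reverse hypercontractivity for the indicator of
  \<open>B\<close> and for \<open>g = h powr (- (1 + a))\<close>, with \<open>q = a / (1 + a)\<close>, has the same quantity \<open>N\<close> on
  both sides: \<open>g powr q = h powr (- a)\<close>, and integrating out \<open>x\<close> turns the mean of
  \<open>indicator B x * g y\<close> into that of \<open>h y * g y = h y powr (- a)\<close>. So
  \<open>(1/2) powr (1/p) * N powr (1/q) \<le> N\<close>, and since \<open>1/q > 1\<close> this bounds \<open>N\<close> from above.
\<close>

lemma hit_prob_negative_moment:
  fixes a p \<rho> :: real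
  assumes a: "0 < a" and p: "0 < p" "p < 1" "1 - p = \<rho>\<^sup>2 * (1 + a)" and \<rho>: "0 < \<rho>" "\<rho> < 1"
    and n: "n \<ge> 1" and card: "card (cube n \<inter> B) = 2 ^ (n - 1)"
  shows "(1/2)^n * (\<Sum>y\<in>cube n. hit_prob \<rho> n B y powr (- a)) \<le> 2 powr (a / p)"
proof -
  define q where "q = a / (1 + a)"
  have q: "0 < q" "q < 1" "1 - q = 1 / (1 + a)" "q * (1 + a) = a"
    using a by (auto simp: q_def field_simps)
  define h where "h = hit_prob \<rho> n B"
  have B_ne: "cube n \<inter> B \<noteq> {}" using card by (metis card.empty power_eq_0_iff zero_neq_numeral)
  have hpos: "h y > 0" for y
    unfolding h_def hit_prob_def using B_ne \<rho>
    by (intro sum_pos flip_prob_pos) auto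
  define N where "N = (1/2)^n * (\<Sum>y\<in>cube n. h y powr (- a))"
  have cube_ne: "cube n \<noteq> {}" using B_ne by blast
  have Npos: "N > 0" unfolding N_def
    using cube_ne hpos by (intro mult_pos_pos sum_pos) (auto simp: less_imp_neq[THEN not_sym])
  have "((1/2)^n * (\<Sum>x\<in>cube n. (indicator B x :: real) powr p)) powr (1 / p)
       * ((1/2)^n * (\<Sum>y\<in>cube n. (h y powr (- (1 + a))) powr q)) powr (1 / q)
    \<le> (1/2)^n * (\<Sum>x\<in>cube n. \<Sum>y\<in>cube n. flip_prob \<rho> n x y * indicator B x * h y powr (- (1 + a)))"
    using \<rho> p q a by (intro reverse_hypercontractivity) auto
  also have "(\<Sum>x\<in>cube n. (indicator B x :: real) powr p) = (\<Sum>x\<in>cube n. indicator B x)"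
    by (intro sum.cong refl) (auto simp: indicator_def)
  also have "(\<Sum>x\<in>cube n. indicator B x :: real) = 2 ^ (n - 1)"
  proof -
    have "(\<Sum>x\<in>cube n. indicator B x :: real) = (\<Sum>x\<in>cube n \<inter> B. 1)"
      unfolding indicator_def of_bool_def
      by (rule sum.inter_restrict[OF finite_cube, symmetric])
    then show ?thesis using card by simp
  qed
  also have "(1/2)^n * (2::real)^(n-1) = 1/2"
    using n by (cases n) (auto simp: power_one_over)
  also have "(\<Sum>y\<in>cube n. (h y powr (- (1 + a))) powr q) = (\<Sum>y\<in>cube n. h y powr (- a))"
  proof -
    have "- (1 + a) * q = - a" using q(4) by (simp add: algebra_simps)
    then show ?thesis by (simp only: powr_powr)
  qed
  also have "(\<Sum>x\<in>cube n. \<Sum>y\<in>cube n. flip_prob \<rho> n x y * indicator B x * h y powr (- (1 + a)))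
      = (\<Sum>y\<in>cube n. h y powr (- a))"
  proof (subst sum.swap, rule sum.cong[OF refl])
    fix y assume "y \<in> cube n"
    have e: "h y = (\<Sum>x\<in>cube n. flip_prob \<rho> n x y * indicator B x)"
      unfolding h_def hit_prob_def sum.inter_restrict[OF finite_cube]
      by (intro sum.cong) (auto simp: indicator_def)
    have "(\<Sum>x\<in>cube n. flip_prob \<rho> n x y * indicator B x * h y powr (- (1 + a)))
        = h y * h y powr (- (1 + a))"
      unfolding sum_distrib_right[symmetric] e[symmetric] ..
    also have "\<dots> = h y powr (1 + - (1 + a))" using hpos[of y] by (subst powr_add) simp
    finally show "(\<Sum>x\<in>cube n. flip_prob \<rho> n x y * indicator B x * h y powr (- (1 + a)))
        = h y powr (- a)" by simp
  qed
  finally have *: "(1/2) powr (1 / p) * N powr (1 / q) \<le> N" by (simp add: N_def)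
  \<comment> \<open>Since \<open>1/q = 1 + 1/a\<close>, one factor \<open>N\<close> cancels.\<close>
  have "N powr (1 / q) = N * N powr (1 / a)"
  proof -
    have "1 / q = 1 + 1 / a" using a by (simp add: q_def field_simps)
    then show ?thesis using Npos by (simp add: powr_add)
  qed
  then have "N * ((1/2) powr (1 / p) * N powr (1 / a)) \<le> N * 1" using * by (simp add: mult_ac)
  then have "(1/2) powr (1 / p) * N powr (1 / a) \<le> 1"
    using Npos by (metis mult_le_cancel_left_pos)
  then have "N powr (1 / a) \<le> 2 powr (1 / p)"
    by (simp add: powr_divide field_simps)
  then have "(N powr (1 / a)) powr a \<le> (2 powr (1 / p)) powr a"
    using a by (intro powr_mono2) auto
  then show ?thesis using a Npos by (simp add: powr_powr N_def h_def)
qed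

lemma exp_le_powr:
  fixes a z :: real
  assumes "0 < a" "0 < z"
  shows "exp (- z) \<le> a powr a * z powr (- a)"
proof -
  have "ln (z / a) \<le> z / a - 1" using assms by (intro ln_le_minus_one) simp
  then have "a * ln (z / a) \<le> a * (z / a - 1)" using assms by (intro mult_left_mono) auto
  then have "- z \<le> a * ln a - a * ln z"
    using assms by (simp add: ln_div algebra_simps)
  then have "exp (- z) \<le> exp (a * ln a - a * ln z)" by simp
  then show ?thesis using assms by (simp add: powr_def exp_diff exp_minus field_simps)
qed

text \<open>
  \<open>(1 - h) ^ k \<le> exp (- k h)\<close>, and the exponential is traded for the negative power of \<open>h\<close>
  whose mean is bounded.
\<close>

lemma miss_moment_le:
  fixes a p \<rho> :: real
  assumes a: "0 < a" and p: "0 < p" "p < 1" "1 - p = \<rho>\<^sup>2 * (1 + a)" and \<rho>: "0 < \<rho>" "\<rho> < 1"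
    and n: "n \<ge> 1" and card: "card (cube n \<inter> B) = 2 ^ (n - 1)" and k: "k \<ge> 1"
  shows "(1/2)^n * (\<Sum>y\<in>cube n. (1 - hit_prob \<rho> n B y) ^ k)
    \<le> a powr a * 2 powr (a / p) * real k powr (- a)"
proof -
  have B_ne: "cube n \<inter> B \<noteq> {}" using card by (metis card.empty power_eq_0_iff zero_neq_numeral)
  have hpos: "hit_prob \<rho> n B y > 0" for y
    unfolding hit_prob_def using B_ne \<rho> by (intro sum_pos flip_prob_pos) auto
  have le: "(1 - hit_prob \<rho> n B y) ^ k \<le> a powr a * real k powr (- a) * hit_prob \<rho> n B y powr (- a)"
    if y: "y \<in> cube n" for y
  proof -
    let ?h = "hit_prob \<rho> n B y"
    have "1 - ?h \<ge> 0" using hit_prob_compl[OF y, of \<rho> B] hit_prob_nonneg[of \<rho> n "- B" y] \<rho> by simp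
    then have "(1 - ?h) ^ k \<le> exp (- ?h) ^ k"
      using exp_ge_add_one_self[of "- ?h"] by (intro power_mono) auto
    also have "\<dots> = exp (- (real k * ?h))" by (simp add: exp_of_nat_mult[symmetric])
    also have "\<dots> \<le> a powr a * (real k * ?h) powr (- a)"
      using a k hpos[of y] by (intro exp_le_powr) auto
    finally show ?thesis using k hpos[of y] by (simp add: powr_mult mult_ac)
  qed
  have "(1/2)^n * (\<Sum>y\<in>cube n. (1 - hit_prob \<rho> n B y) ^ k)
      \<le> (1/2)^n * (\<Sum>y\<in>cube n. a powr a * real k powr (- a) * hit_prob \<rho> n B y powr (- a))"
    by (intro mult_left_mono sum_mono le) auto
  also have "\<dots> = a powr a * real k powr (- a) * ((1/2)^n * (\<Sum>y\<in>cube n. hit_prob \<rho> n B y powr (- a)))"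
    by (simp add: sum_distrib_left mult_ac)
  also have "\<dots> \<le> a powr a * real k powr (- a) * 2 powr (a / p)"
    using assms by (intro mult_left_mono hit_prob_negative_moment) auto
  finally show ?thesis by (simp add: mult_ac)
qed

section \<open>Success probability on the star\<close>

lemma strings_prob_Star:
  "strings_prob (Star k) \<rho> n x = (1/2)^n * (\<Prod>j\<in>{1..k}. flip_prob \<rho> n (x j) (x 0))"
  unfolding strings_prob_def coord_prob_Star flip_prob_def
  by (simp only: prod.distrib prod_constant card_lessThan) (subst prod.swap, rule refl)

text \<open>
  Given the string \<open>y\<close> of the centre, the leaves are independent \<open>\<rho>\<close>-correlated copies of \<open>y\<close>.
\<close>

lemma sum_strings_prob_Star_leaves_in:
  "(\<Sum>x\<in>{x \<in> vertices (Star k) \<rightarrow>\<^sub>E cube n. \<forall>j\<in>{1..k}. x j \<in> B j}. strings_prob (Star k) \<rho> n x)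
   = (1/2)^n * (\<Sum>y\<in>cube n. \<Prod>j\<in>{1..k}. hit_prob \<rho> n (B j) y)"
proof -
  let ?X = "\<lambda>j. cube n \<inter> B j"
  let ?P = "PiE {1..k} ?X"
  have "{x \<in> vertices (Star k) \<rightarrow>\<^sub>E cube n. \<forall>j\<in>{1..k}. x j \<in> B j}
      = (\<lambda>(y, x). x(0 := y)) ` (cube n \<times> ?P)" (is "?L = ?R")
  proof
    show "?R \<subseteq> ?L"
      by (auto simp: Star_def PiE_def extensional_def Pi_def)
    show "?L \<subseteq> ?R"
    proof
      fix x assume x: "x \<in> ?L"
      show "x \<in> ?R"
      proof (rule image_eqI[of _ _ "(x 0, x(0 := undefined))"])
        show "x = (case (x 0, x(0 := undefined)) of (y, x) \<Rightarrow> x(0 := y))" by auto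
        show "(x 0, x(0 := undefined)) \<in> cube n \<times> ?P"
          using x by (auto simp: Star_def PiE_def extensional_def Pi_def)
      qed
    qed
  qed
  moreover have "inj_on (\<lambda>(y, x). x(0 := y)) (cube n \<times> ?P)"
    by (rule inj_on_inverseI[where g = "\<lambda>x. (x 0, x(0 := undefined))"])
       (auto simp: PiE_def extensional_def fun_upd_idem)
  ultimately have "(\<Sum>x\<in>{x \<in> vertices (Star k) \<rightarrow>\<^sub>E cube n. \<forall>j\<in>{1..k}. x j \<in> B j}. strings_prob (Star k) \<rho> n x)
      = (\<Sum>(y, x)\<in>cube n \<times> ?P. strings_prob (Star k) \<rho> n (x(0 := y)))"
    by (simp add: sum.reindex split_def)
  also have "\<dots> = (\<Sum>y\<in>cube n. \<Sum>x\<in>?P. (1/2)^n * (\<Prod>j\<in>{1..k}. flip_prob \<rho> n (x j) y))"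
    unfolding sum.cartesian_product[symmetric] strings_prob_Star
    by (intro sum.cong refl arg_cong2[where f = "(*)"] prod.cong) auto
  also have "\<dots> = (1/2)^n * (\<Sum>y\<in>cube n. \<Sum>x\<in>?P. \<Prod>j\<in>{1..k}. flip_prob \<rho> n (x j) y)"
    by (simp add: sum_distrib_left)
  also have "\<dots> = (1/2)^n * (\<Sum>y\<in>cube n. \<Prod>j\<in>{1..k}. hit_prob \<rho> n (B j) y)"
    unfolding hit_prob_def
    by (intro arg_cong2[where f = "(*)"] sum.cong refl prod_sum_PiE[symmetric]) auto
  finally show ?thesis .
qed

lemma success_prob_Star_eq:
  assumes k: "k \<ge> 1" and f: "\<And>v. v \<in> {1..k} \<Longrightarrow> f v \<in> cube n \<rightarrow> {-1, 1::int}"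
  shows "success_prob (Star k) \<rho> n (star_leaves k) f
    = (1/2)^n * (\<Sum>y\<in>cube n. \<Prod>v\<in>{1..k}. hit_prob \<rho> n {x. f v x = 1} y)
    + (1/2)^n * (\<Sum>y\<in>cube n. \<Prod>v\<in>{1..k}. hit_prob \<rho> n {x. f v x = -1} y)"
proof -
  let ?E = "\<lambda>b. {x \<in> vertices (Star k) \<rightarrow>\<^sub>E cube n. \<forall>v\<in>{1..k}. x v \<in> {z. f v z = b}}"
  have "{x \<in> vertices (Star k) \<rightarrow>\<^sub>E cube n. \<forall>u\<in>star_leaves k. \<forall>v\<in>star_leaves k. f u (x u) = f v (x v)}
      = ?E 1 \<union> ?E (-1)" (is "?L = _")
  proof
    show "?E 1 \<union> ?E (-1) \<subseteq> ?L" unfolding star_leaves_def by auto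
    show "?L \<subseteq> ?E 1 \<union> ?E (-1)"
    proof
      fix x assume x: "x \<in> ?L"
      have 1: "1 \<in> {1..k}" using k by simp
      have "x \<in> vertices (Star k) \<rightarrow>\<^sub>E cube n" using x by blast
      then have "x 1 \<in> cube n" by (rule PiE_mem) (use k in \<open>simp add: Star_def\<close>)
      define c where "c = f 1 (x 1)"
      have "c \<in> {-1, 1}" unfolding c_def using f[OF 1] \<open>x 1 \<in> cube n\<close> by blast
      moreover have "f v (x v) = c" if "v \<in> {1..k}" for v
        using x that 1 unfolding star_leaves_def c_def by blast
      ultimately have "(\<forall>v\<in>{1..k}. x v \<in> {z. f v z = 1}) \<or> (\<forall>v\<in>{1..k}. x v \<in> {z. f v z = -1})"
        by auto
      then show "x \<in> ?E 1 \<union> ?E (-1)" using x by blast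
    qed
  qed
  \<comment> \<open>With no leaves at all the two events would coincide.\<close>
  moreover have "?E 1 \<inter> ?E (-1) = {}" using k by force
  moreover have "finite (vertices (Star k) \<rightarrow>\<^sub>E cube n)"
    by (intro finite_PiE) (auto simp: Star_def)
  ultimately have "success_prob (Star k) \<rho> n (star_leaves k) f
      = sum (strings_prob (Star k) \<rho> n) (?E 1) + sum (strings_prob (Star k) \<rho> n) (?E (-1))"
    unfolding success_prob_def by (simp add: sum.union_disjoint)
  then show ?thesis
    unfolding sum_strings_prob_Star_leaves_in .
qed

section \<open>Upper bound for all protocols\<close>

text \<open>
  The inequality of arithmetic and geometric means for the numbers \<open>g i ^ card S\<close>. It replaces Hoelder's
  inequality in reducing a protocol to its single players.
\<close>

lemma prod_le_mean_of_powers: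
  fixes g :: "'a \<Rightarrow> real"
  assumes "finite S" "S \<noteq> {}" and g: "\<And>i. i \<in> S \<Longrightarrow> 0 \<le> g i"
  shows "(\<Prod>i\<in>S. g i) \<le> (\<Sum>i\<in>S. g i ^ card S) / card S"
proof -
  have c: "card S > 0" using assms by (simp add: card_gt_0_iff)
  have root: "x = (x ^ card S) powr (1 / card S)" if "x \<ge> 0" for x :: real
    using c that by (cases "x = 0") (auto simp: powr_realpow[symmetric] powr_powr)
  have "(\<Prod>i\<in>S. g i) = (\<Prod>i\<in>S. g i ^ card S) powr (1 / card S)"
    unfolding prod_power_distrib[symmetric] by (intro root prod_nonneg g)
  also have "\<dots> \<le> (\<Sum>i\<in>S. g i ^ card S / card S)"
    using assms by (intro arith_geom_mean) auto
  finally show ?thesis by (simp add: sum_divide_distrib)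
qed

text \<open>
  All players agree on \<open>b\<close> only if each avoids the output \<open>- b\<close>, an event of density \<open>1/2\<close>;
  the factor \<open>2\<close> counts the two values of \<open>b\<close>.
\<close>

lemma max_success_Star_le:
  fixes a p \<rho> :: real
  assumes a: "0 < a" and p: "0 < p" "p < 1" "1 - p = \<rho>\<^sup>2 * (1 + a)" and \<rho>: "0 < \<rho>" "\<rho> < 1"
    and k: "k \<ge> 1"
  shows "max_success (Star k) \<rho> (star_leaves k) \<le> 2 * (a powr a * 2 powr (a / p) * real k powr (- a))"
proof -
  let ?C = "a powr a * 2 powr (a / p) * real k powr (- a)"
  have one: "(1/2)^n * (\<Sum>y\<in>cube n. \<Prod>v\<in>{1..k}. hit_prob \<rho> n (A v) y) \<le> ?C"
    if n: "n \<ge> 1" and A: "\<And>v. v \<in> {1..k} \<Longrightarrow> card (cube n \<inter> - A v) = 2 ^ (n - 1)"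
    for n and A :: "nat \<Rightarrow> (nat \<Rightarrow> int) set"
  proof -
    have "(1/2)^n * (\<Sum>y\<in>cube n. \<Prod>v\<in>{1..k}. hit_prob \<rho> n (A v) y)
        \<le> (1/2)^n * (\<Sum>y\<in>cube n. (\<Sum>v\<in>{1..k}. hit_prob \<rho> n (A v) y ^ k) / k)"
      using k \<rho> prod_le_mean_of_powers[of "{1..k}" "\<lambda>v. hit_prob \<rho> n (A v) _"]
      by (intro mult_left_mono sum_mono) (auto simp: hit_prob_nonneg)
    also have "\<dots> = (\<Sum>v\<in>{1..k}. (1/2)^n * (\<Sum>y\<in>cube n. hit_prob \<rho> n (A v) y ^ k)) / k"
      unfolding sum_divide_distrib[symmetric] sum_distrib_left[symmetric]
      by (subst sum.swap) simp
    also have "\<dots> \<le> (\<Sum>v\<in>{1..k}. ?C) / k"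
    proof (intro divide_right_mono sum_mono)
      fix v assume v: "v \<in> {1..k}"
      have "(\<Sum>y\<in>cube n. hit_prob \<rho> n (A v) y ^ k) = (\<Sum>y\<in>cube n. (1 - hit_prob \<rho> n (- A v) y) ^ k)"
        by (intro sum.cong refl) (simp add: hit_prob_compl)
      then show "(1/2)^n * (\<Sum>y\<in>cube n. hit_prob \<rho> n (A v) y ^ k) \<le> ?C"
        using miss_moment_le[OF a p \<rho> n A[OF v] k] by simp
    qed simp
    also have "\<dots> = ?C" using k by simp
    finally show ?thesis .
  qed
  \<comment> \<open>The sets \<open>{f v = 1}\<close> and \<open>{f v = -1}\<close> have density \<open>1/2\<close> by balance, so \<open>one\<close> applies to each.\<close>
  have "success_prob (Star k) \<rho> n (star_leaves k) f \<le> 2 * ?C"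
    if n: "n \<ge> 1" and f: "f \<in> protocols n (star_leaves k)" for n f
  proof -
    have bal: "balanced n (f v)" if "v \<in> {1..k}" for v
      using f that by (simp add: protocols_def star_leaves_def)
    have compl: "cube n \<inter> - {x. f v x = 1} = {x \<in> cube n. f v x = -1}"
         "cube n \<inter> - {x. f v x = -1} = {x \<in> cube n. f v x = 1}" if "v \<in> {1..k}" for v
      using bal[OF that] unfolding balanced_def Pi_def by fastforce+
    have "card (cube n \<inter> - {x. f v x = 1}) = 2 ^ (n - 1)"
         "card (cube n \<inter> - {x. f v x = -1}) = 2 ^ (n - 1)" if "v \<in> {1..k}" for v
      using bal[OF that] unfolding compl[OF that] balanced_def by auto
    then show ?thesis
      using one[OF n, of "\<lambda>v. {x. f v x = 1}"] one[OF n, of "\<lambda>v. {x. f v x = -1}"] bal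
      by (subst success_prob_Star_eq[OF k]) (auto simp: balanced_def)
  qed
  then show ?thesis
    unfolding max_success_def max_success_n_def
    by (intro cSUP_least protocols_nonempty) auto
qed

text \<open>
  Apply the preceding bound with \<open>a = \<nu> - \<epsilon>/2\<close>, which makes \<open>p = \<rho>\<^sup>2 \<epsilon> / 2\<close>; the other
  \<open>\<epsilon>/2\<close> absorbs the constant. If \<open>\<nu> \<le> \<epsilon>\<close>, in particular if \<open>\<rho> = 1\<close>, the claimed bound
  is at least \<open>1\<close>.
\<close>

lemma max_success_upper_bound:
  fixes \<epsilon> \<rho> :: real
  assumes \<rho>: "0 < \<rho>" "\<rho> \<le> 1" and \<epsilon>: "\<epsilon> > 0"
  shows "\<forall>\<^sub>F k in sequentially. max_success (Star k) \<rho> (star_leaves k) \<le> real k powr (- star_exponent \<rho> + \<epsilon>)"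
proof (cases "star_exponent \<rho> \<le> \<epsilon>")
  case True
  show ?thesis using eventually_ge_at_top[of 1]
  proof eventually_elim
    case (elim k)
    have "max_success (Star k) \<rho> (star_leaves k) \<le> 1"
      unfolding max_success_def max_success_n_def using \<rho>
      by (intro cSUP_least protocols_nonempty success_prob_Star_bounds) auto
    also have "1 \<le> real k powr (- star_exponent \<rho> + \<epsilon>)"
      using elim True by (intro ge_one_powr_ge_zero) auto
    finally show ?case .
  qed
next
  case False
  define a where "a = star_exponent \<rho> - \<epsilon> / 2"
  define p where "p = \<rho>\<^sup>2 * \<epsilon> / 2"
  have "\<rho> \<noteq> 1" using False \<epsilon> by (auto simp: star_exponent_def)
  then have \<rho>1: "\<rho> < 1" using \<rho> by simp
  have a: "a > 0" using False \<epsilon> by (simp add: a_def)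
  have pa: "1 - p = \<rho>\<^sup>2 * (1 + a)"
    using \<rho> by (simp add: a_def p_def star_exponent_def field_simps)
  have p: "0 < p" "p < 1"
  proof -
    show "0 < p" using \<rho> \<epsilon> by (simp add: p_def)
    have "\<rho>\<^sup>2 * (1 + a) > 0" using \<rho> a by simp
    then show "p < 1" using pa by simp
  qed
  define C where "C = 2 * (a powr a * 2 powr (a / p))"
  have "\<forall>\<^sub>F k in sequentially. C \<le> real k powr (\<epsilon> / 2)"
  proof -
    have "filterlim (\<lambda>k. real k powr (\<epsilon> / 2)) at_top sequentially" using \<epsilon> by real_asymp
    then show ?thesis unfolding filterlim_at_top by blast
  qed
  then show ?thesis using eventually_ge_at_top[of 1]
  proof eventually_elim
    case (elim k)
    have "max_success (Star k) \<rho> (star_leaves k) \<le> C * real k powr (- a)"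
      using max_success_Star_le[OF a p pa \<rho>(1) \<rho>1 elim(2)] by (simp add: C_def)
    also have "\<dots> \<le> real k powr (\<epsilon> / 2) * real k powr (- a)"
      using elim by (intro mult_right_mono) auto
    also have "\<dots> = real k powr (- star_exponent \<rho> + \<epsilon>)"
      by (simp add: powr_add[symmetric] a_def)
    finally show ?case .
  qed
qed

section \<open>Deviations of sums of signs\<close>

text \<open>
  The left-hand side is the mean of \<open>exp (- h x)\<close> for a sign \<open>x\<close> of mean \<open>r\<close>. Its variance is
  \<open>1 - r\<^sup>2\<close>, so any \<open>c\<close> above half of that works for small \<open>h\<close>. The general bound for signs
  would have \<open>c = 1/2\<close>, which is too weak for the sharp exponent.
\<close>

lemma noisy_step_mgf_le:
  fixes c r :: real
  assumes "c > (1 - r\<^sup>2) / 2"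
  shows "\<forall>\<^sub>F h in at_right 0. cosh h - r * sinh h \<le> exp (c * h\<^sup>2 - r * h)"
proof -
  have c: "r * r / 2 + c - 1 / 2 > 0" using assms by (simp add: power2_eq_square field_simps)
  have "((\<lambda>h. (exp (c * h\<^sup>2 - r * h) - (cosh h - r * sinh h)) / h\<^sup>2) \<longlongrightarrow> r * r / 2 + c - 1 / 2) (at_right 0)"
    by real_asymp
  then have "\<forall>\<^sub>F h in at_right 0. (exp (c * h\<^sup>2 - r * h) - (cosh h - r * sinh h)) / h\<^sup>2 > 0"
    using c by (rule order_tendstoD)
  then show ?thesis
    by (rule eventually_mono) (auto simp: zero_less_divide_iff)
qed

text \<open>
  Chernoff's bound for a leaf conditioned on the centre: each coordinate contributes
  \<open>cosh h - \<rho> y\<^sub>i sinh h\<close>, and the two assumptions cover the two signs of \<open>y\<^sub>i\<close>.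
\<close>

lemma sum_string_le_given_center:
  fixes c h \<rho> :: real
  assumes \<rho>: "0 < \<rho>" "\<rho> \<le> 1" and h: "h \<ge> 0" and y: "y \<in> cube n"
    and step: "cosh h - \<rho> * sinh h \<le> exp (c * h\<^sup>2 - \<rho> * h)"
              "cosh h + \<rho> * sinh h \<le> exp (c * h\<^sup>2 + \<rho> * h)"
  shows "hit_prob \<rho> n {x. (\<Sum>i<n. x i) \<le> 0} y \<le> exp (n * c * h\<^sup>2 - \<rho> * h * (\<Sum>i<n. y i))"
proof -
  let ?w = "\<lambda>i a. if a = y i then 1/2 + 1/2 * \<rho> else 1/2 - 1/2 * \<rho>"
  have "hit_prob \<rho> n {x. (\<Sum>i<n. x i) \<le> 0} y
      \<le> (\<Sum>x\<in>cube n \<inter> {x. (\<Sum>i<n. x i) \<le> 0}. flip_prob \<rho> n x y * exp (- h * (\<Sum>i<n. x i)))"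
    unfolding hit_prob_def
  proof (rule sum_mono)
    fix x assume x: "x \<in> cube n \<inter> {x. (\<Sum>i<n. x i) \<le> 0}"
    then have "real_of_int (\<Sum>i<n. x i) \<le> 0" by (subst of_int_le_0_iff) simp
    then have "1 \<le> exp (- h * (\<Sum>i<n. x i))"
      using h by (simp add: mult_nonneg_nonpos)
    then show "flip_prob \<rho> n x y \<le> flip_prob \<rho> n x y * exp (- h * (\<Sum>i<n. x i))"
      using flip_prob_nonneg[of \<rho> n x y] \<rho> by (simp add: mult_le_cancel_left1)
  qed
  also have "\<dots> \<le> (\<Sum>x\<in>cube n. flip_prob \<rho> n x y * exp (- h * (\<Sum>i<n. x i)))"
    using \<rho> by (intro sum_mono2) (auto simp: flip_prob_nonneg)
  also have "\<dots> = (\<Sum>x\<in>cube n. \<Prod>i<n. ?w i (x i) * exp (- h * x i))"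
    by (simp add: flip_prob_def prod.distrib sum_distrib_left exp_sum)
  also have "\<dots> = (\<Prod>i<n. ?w i 1 * exp (- h * real_of_int 1) + ?w i (-1) * exp (- h * real_of_int (-1)))"
    by (rule sum_cube_prod[where F = "\<lambda>i a. ?w i a * exp (- h * real_of_int a)"])
  also have "\<dots> \<le> (\<Prod>i<n. exp (c * h\<^sup>2 - \<rho> * h * y i))"
  proof (intro prod_mono conjI)
    fix i assume "i \<in> {..<n}"
    then have yi: "y i = 1 \<or> y i = -1" using y unfolding cube_def by (auto dest: PiE_mem)
    show "0 \<le> ?w i 1 * exp (- h * real_of_int 1) + ?w i (-1) * exp (- h * real_of_int (-1))"
      using \<rho> by (intro add_nonneg_nonneg mult_nonneg_nonneg) auto
    show "?w i 1 * exp (- h * real_of_int 1) + ?w i (-1) * exp (- h * real_of_int (-1))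
        \<le> exp (c * h\<^sup>2 - \<rho> * h * y i)"
      using yi
      by (elim disjE) (use step in \<open>simp_all add: cosh_field_def sinh_field_def field_simps\<close>)
  qed
  also have "\<dots> = exp (\<Sum>i<n. c * h\<^sup>2 - \<rho> * h * y i)" by (simp add: exp_sum)
  also have "(\<Sum>i<n. c * h\<^sup>2 - \<rho> * h * y i) = n * c * h\<^sup>2 - \<rho> * h * (\<Sum>i<n. y i)"
    by (simp add: sum_subtractf sum_distrib_left)
  finally show ?thesis by simp
qed

lemma uniform_mgf: "(1/2)^n * (\<Sum>x\<in>cube n. exp (\<theta> * (\<Sum>i<n. x i))) = cosh \<theta> ^ n" for \<theta> :: real
proof -
  have "(\<Sum>x\<in>cube n. exp (\<theta> * (\<Sum>i<n. x i))) = (\<Sum>x\<in>cube n. \<Prod>i<n. exp (\<theta> * x i))"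
    by (simp add: sum_distrib_left exp_sum)
  also have "\<dots> = (exp \<theta> + exp (- \<theta>)) ^ n"
    by (subst sum_cube_prod[where F = "\<lambda>i a. exp (\<theta> * real_of_int a)"]) simp
  also have "exp \<theta> + exp (- \<theta>) = 2 * cosh \<theta>" by (simp add: cosh_field_def)
  finally show ?thesis by (simp add: power_mult_distrib power_one_over)
qed

text \<open>
  Change of measure. Tilting the uniform law by \<open>exp (h s)\<close>, where \<open>s\<close> is the sum of the
  coordinates, makes the window \<open>a \<le> s \<le> b\<close> typical. On the window the tilt is at most
  \<open>exp (h b)\<close>, and the two subtracted terms are exponential Markov bounds for the tilted mass
  below \<open>a\<close> and above \<open>b\<close>. All three terms are values of the moment generating function
  \<open>cosh \<theta> ^ n\<close>, whose limits are explicit under the scaling \<open>\<theta> \<sim> 1 / \<surd>n\<close>.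
\<close>

lemma uniform_tail_ge:
  fixes a b h \<alpha> :: real
  assumes "h \<ge> 0" "\<alpha> \<ge> 0"
  shows "exp (- h * b) * (cosh h ^ n - exp (\<alpha> * a) * cosh (h - \<alpha>) ^ n - exp (- \<alpha> * b) * cosh (h + \<alpha>) ^ n)
    \<le> (1/2)^n * card {x \<in> cube n. a \<le> (\<Sum>i<n. x i)}"
proof -
  define S :: "(nat \<Rightarrow> int) \<Rightarrow> real" where "S x = (\<Sum>i<n. real_of_int (x i))" for x
  \<comment> \<open>The inequality holds pointwise: outside the window one subtracted term is already at least \<open>exp (h s)\<close>.\<close>
  have pt: "exp (- h * b) * (exp (h * s) - exp (\<alpha> * a) * exp ((h - \<alpha>) * s) - exp (- \<alpha> * b) * exp ((h + \<alpha>) * s))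
      \<le> (if a \<le> s then 1 else 0)" for s
  proof -
    have eq: "exp (\<alpha> * a) * exp ((h - \<alpha>) * s) = exp (h * s) * exp (\<alpha> * (a - s))"
      "exp (- \<alpha> * b) * exp ((h + \<alpha>) * s) = exp (h * s) * exp (\<alpha> * (s - b))"
      by (simp_all add: exp_add[symmetric] algebra_simps)
    consider "s < a" | "b < s" | "a \<le> s" "s \<le> b" by linarith
    then show ?thesis
    proof cases
      case 1
      then have "exp (\<alpha> * (a - s)) \<ge> 1" using assms by simp
      then have "exp (h * s) * (1 - exp (\<alpha> * (a - s)) - exp (\<alpha> * (s - b))) \<le> 0"
        by (intro mult_nonneg_nonpos exp_ge_zero) (smt (verit) exp_ge_zero)
      then have "exp (- h * b) * (exp (h * s) * (1 - exp (\<alpha> * (a - s)) - exp (\<alpha> * (s - b)))) \<le> 0"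
        by (rule mult_nonneg_nonpos[OF exp_ge_zero])
      then show ?thesis unfolding eq using 1 by (simp add: right_diff_distrib)
    next
      case 2
      then have "exp (\<alpha> * (s - b)) \<ge> 1" using assms by simp
      then have "exp (h * s) * (1 - exp (\<alpha> * (a - s)) - exp (\<alpha> * (s - b))) \<le> 0"
        by (intro mult_nonneg_nonpos exp_ge_zero) (smt (verit) exp_ge_zero)
      then have "exp (- h * b) * (exp (h * s) * (1 - exp (\<alpha> * (a - s)) - exp (\<alpha> * (s - b)))) \<le> 0"
        by (rule mult_nonneg_nonpos[OF exp_ge_zero])
      then show ?thesis unfolding eq by (auto simp: right_diff_distrib)
    next
      case 3
      have "exp (- h * b) * (exp (h * s) - exp (\<alpha> * a) * exp ((h - \<alpha>) * s) - exp (- \<alpha> * b) * exp ((h + \<alpha>) * s))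
          \<le> exp (- h * b) * exp (h * s)"
        by (intro mult_left_mono) (auto simp: algebra_simps)
      also have "\<dots> = exp (h * (s - b))" by (simp add: exp_add[symmetric] algebra_simps)
      also have "\<dots> \<le> 1" using 3 assms by (simp add: mult_nonneg_nonpos)
      finally show ?thesis using 3 by simp
    qed
  qed
  have "exp (- h * b) * (cosh h ^ n - exp (\<alpha> * a) * cosh (h - \<alpha>) ^ n - exp (- \<alpha> * b) * cosh (h + \<alpha>) ^ n)
    = (1/2)^n * (\<Sum>x\<in>cube n. exp (- h * b) * (exp (h * S x) - exp (\<alpha> * a) * exp ((h - \<alpha>) * S x)
        - exp (- \<alpha> * b) * exp ((h + \<alpha>) * S x)))"
    unfolding uniform_mgf[symmetric] S_def sum_distrib_left[symmetric] sum_subtractf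
    by (simp add: algebra_simps)
  also have "\<dots> \<le> (1/2)^n * (\<Sum>x\<in>cube n. if a \<le> S x then 1 else 0)"
    by (intro mult_left_mono sum_mono pt) simp
  also have "(\<Sum>x\<in>cube n. if a \<le> S x then 1 else (0::real)) = card {x \<in> cube n. a \<le> S x}"
    by (simp add: sum.If_cases Int_def conj_commute)
  finally show ?thesis by (simp add: S_def)
qed

lemma tendsto_cosh_power: "(\<lambda>n. cosh (l / sqrt (real n)) ^ n) \<longlonglongrightarrow> exp (l\<^sup>2 / 2)" for l :: real
  unfolding power2_eq_square by real_asymp

text \<open>
  Take the tilt \<open>h = (t + 2) / \<surd>n\<close>, which centres the sum at about \<open>(t + 2) \<surd>n\<close>, the window
  of half-width \<open>2 \<surd>n\<close> around that centre, and \<open>\<alpha> = 2 / \<surd>n\<close>. In the limit each of the two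
  tilted tails has mass at most \<open>exp (- 2) < 1/4\<close>, so half of the tilted mass stays in the window.
\<close>

lemma uniform_tail_asymp:
  fixes t :: real
  assumes t: "t \<ge> 0"
  shows "\<forall>\<^sub>F n in sequentially. 1/2 * exp (- (t\<^sup>2 / 2 + 4 * t + 6))
    \<le> (1/2)^n * card {x \<in> cube n. t * sqrt n \<le> (\<Sum>i<n. x i)}"
proof -
  define \<tau> where "\<tau> = t + 2"
  let ?f = "\<lambda>n. exp (- \<tau> * (\<tau> + 2)) * (cosh (\<tau> / sqrt (real n)) ^ n
      - exp (2 * (\<tau> - 2)) * cosh ((\<tau> - 2) / sqrt (real n)) ^ n
      - exp (- 2 * (\<tau> + 2)) * cosh ((\<tau> + 2) / sqrt (real n)) ^ n)"
  have "?f \<longlonglongrightarrow> exp (- \<tau> * (\<tau> + 2)) * (exp (\<tau>\<^sup>2 / 2)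
      - exp (2 * (\<tau> - 2)) * exp ((\<tau> - 2)\<^sup>2 / 2) - exp (- 2 * (\<tau> + 2)) * exp ((\<tau> + 2)\<^sup>2 / 2))"
    by (intro tendsto_intros tendsto_cosh_power)
  also have "exp (2 * (\<tau> - 2)) * exp ((\<tau> - 2)\<^sup>2 / 2) = exp (\<tau>\<^sup>2 / 2) * exp (- 2)"
    by (simp add: exp_add[symmetric] power2_eq_square field_simps)
  also have "exp (- 2 * (\<tau> + 2)) * exp ((\<tau> + 2)\<^sup>2 / 2) = exp (\<tau>\<^sup>2 / 2) * exp (- 2)"
    by (simp add: exp_add[symmetric] power2_eq_square field_simps)
  also have "exp (- \<tau> * (\<tau> + 2)) * (exp (\<tau>\<^sup>2 / 2) - exp (\<tau>\<^sup>2 / 2) * exp (- 2) - exp (\<tau>\<^sup>2 / 2) * exp (- 2))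
      = (1 - 2 * exp (- 2)) * (exp (- \<tau> * (\<tau> + 2)) * exp (\<tau>\<^sup>2 / 2))" by (simp add: algebra_simps)
  also have "exp (- \<tau> * (\<tau> + 2)) * exp (\<tau>\<^sup>2 / 2) = exp (- (t\<^sup>2 / 2 + 4 * t + 6))"
    by (simp add: \<tau>_def exp_add[symmetric] power2_eq_square field_simps)
  finally have lim: "?f \<longlonglongrightarrow> (1 - 2 * exp (- 2)) * exp (- (t\<^sup>2 / 2 + 4 * t + 6))" .
  have "(4::real) < exp 1 * exp 1"
    using exp_ge_add_one_self[of "1::real"] exp_lower_Taylor_quadratic[of "1::real"]
      mult_strict_mono[of 2 "exp 1 :: real" 2 "exp 1"] by simp
  then have "exp (- 2 :: real) < 1 / 4"
    by (simp add: exp_minus exp_add[symmetric] field_simps)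
  then have "1/2 * exp (- (t\<^sup>2 / 2 + 4 * t + 6)) < (1 - 2 * exp (- 2)) * exp (- (t\<^sup>2 / 2 + 4 * t + 6))"
    by (intro mult_strict_right_mono) auto
  from order_tendstoD(1)[OF lim this] show ?thesis using eventually_gt_at_top[of 0]
  proof eventually_elim
    case (elim n)
    let ?r = "sqrt (real n)"
    have r: "?r > 0" using elim by simp
    have "?f n = exp (- (\<tau> / ?r) * ((\<tau> + 2) * ?r)) * (cosh (\<tau> / ?r) ^ n
      - exp ((2 / ?r) * ((\<tau> - 2) * ?r)) * cosh (\<tau> / ?r - 2 / ?r) ^ n
      - exp (- (2 / ?r) * ((\<tau> + 2) * ?r)) * cosh (\<tau> / ?r + 2 / ?r) ^ n)"
      using r by (simp add: diff_divide_distrib add_divide_distrib)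
    also have "\<dots> \<le> (1/2)^n * card {x \<in> cube n. (\<tau> - 2) * ?r \<le> (\<Sum>i<n. x i)}"
      using t r by (intro uniform_tail_ge) (auto simp: \<tau>_def)
    finally show ?case using elim by (simp add: \<tau>_def)
  qed
qed

section \<open>Lower bound by majority\<close>

lemma odd_sum_cube:
  assumes "x \<in> cube n" "odd n"
  shows "(\<Sum>i<n. x i) \<noteq> 0"
proof -
  have "odd (\<Sum>i<m. x i) = odd m" if "m \<le> n" for m
    using that
  proof (induction m)
    case (Suc m)
    then show ?case using cube_mem[OF assms(1), of m] by auto
  qed simp
  from this[of n] assms(2) show ?thesis by auto
qed

lemma MAJ_cube: "odd n \<Longrightarrow> x \<in> cube n \<Longrightarrow> MAJ n x \<in> {-1, 1}"
  using odd_sum_cube[of x n] by (auto simp: MAJ_def sgn_if)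

text \<open>
  Negating all coordinates exchanges the two values of majority.
\<close>

lemma balanced_MAJ:
  assumes "odd n"
  shows "balanced n (MAJ n)"
proof -
  define neg :: "(nat \<Rightarrow> int) \<Rightarrow> nat \<Rightarrow> int" where "neg x = (\<lambda>i\<in>{..<n}. - x i)" for x
  let ?E = "\<lambda>b. {x \<in> cube n. MAJ n x = b}"
  have neg: "neg x \<in> cube n" "neg (neg x) = x" if "x \<in> cube n" for x
  proof -
    show "neg x \<in> cube n"
      unfolding cube_def neg_def
      by (intro restrict_PiE_iff[THEN iffD2] ballI) (use cube_mem[OF that] in auto)
    show "neg (neg x) = x"
    proof
      fix i show "neg (neg x) i = x i"
        using that by (cases "i < n") (auto simp: cube_def PiE_def extensional_def neg_def)
    qed
  qed
  have maj: "MAJ n (neg x) = - MAJ n x" for x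
    by (simp add: MAJ_def neg_def sum_negf)
  have "bij_betw neg (?E 1) (?E (-1))"
    by (rule bij_betw_byWitness[of _ neg]) (auto simp: neg maj)
  then have eq: "card (?E 1) = card (?E (-1))" by (rule bij_betw_same_card)
  have "card (?E 1) + card (?E (-1)) = card (?E 1 \<union> ?E (-1))"
    by (intro card_Un_disjoint[symmetric]) auto
  also have "?E 1 \<union> ?E (-1) = cube n" using MAJ_cube[OF assms] by auto
  also have "card (cube n) = 2 ^ n" by (simp add: cube_def card_PiE numeral_2_eq_2)
  also have "\<dots> = 2 * 2 ^ (n - 1)" using assms by (cases n) auto
  finally show ?thesis using eq MAJ_cube[OF assms] unfolding balanced_def by auto
qed

lemma max_success_Star_ge_MAJ:
  assumes "0 \<le> \<rho>" "\<rho> \<le> 1" "odd n"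
  shows "simple_success_prob (Star k) \<rho> n S (MAJ n) \<le> max_success (Star k) \<rho> S"
proof -
  have n: "n \<ge> 1" using odd_pos[OF assms(3)] by simp
  have "simple_success_prob (Star k) \<rho> n S (MAJ n) \<le> max_success_n (Star k) \<rho> n S"
    unfolding simple_success_prob_def max_success_n_def
    using balanced_MAJ[OF assms(3)]
    by (intro cSUP_upper success_prob_Star_bdd assms) (simp add: protocols_def)
  also have "\<dots> \<le> max_success (Star k) \<rho> S"
    unfolding max_success_def
    by (intro cSUP_upper max_success_n_Star_bdd assms) (use n in simp)
  finally show ?thesis .
qed

text \<open>
  The number \<open>t\<close> solves \<open>\<rho>\<^sup>2 t\<^sup>2 / (4 c) = ln k\<close>. For a centre with \<open>\<Sum>y \<ge> t \<surd>n\<close>, the Chernoff bound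
  with the optimal \<open>h = \<rho> t / (2 c \<surd>n)\<close> gives each leaf a failure probability of at most
  \<open>exp (- \<rho>\<^sup>2 t\<^sup>2 / (4 c)) = 1 / k\<close>.
\<close>

lemma MAJ_success_ge:
  fixes c \<rho> :: real
  assumes \<rho>: "0 < \<rho>" "\<rho> \<le> 1" and c: "c > (1 - \<rho>\<^sup>2) / 2" "c > 0" and k: "k \<ge> 2"
    and t: "t = 2 * sqrt c / \<rho> * sqrt (ln (real k))"
  shows "\<forall>\<^sub>F n in sequentially. odd n \<longrightarrow>
    (1 - 1 / real k) ^ k * (1/2 * exp (- (t\<^sup>2 / 2 + 4 * t + 6)))
      \<le> simple_success_prob (Star k) \<rho> n (star_leaves k) (MAJ n)"
proof -
  have lnk: "ln (real k) > 0" using k by simp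
  have tpos: "t > 0" unfolding t using c \<rho> lnk by simp
  have t2: "\<rho>\<^sup>2 * t\<^sup>2 = 4 * c * ln k"
    unfolding t using c \<rho> lnk by (simp add: power_mult_distrib power_divide)
  define l where "l = \<rho> * t / (2 * c)"
  have l: "l > 0" using \<rho> tpos c by (simp add: l_def)
  have lim: "filterlim (\<lambda>n. l / sqrt (real n)) (at_right 0) sequentially"
    using l by real_asymp
  have "\<forall>\<^sub>F h in at_right 0. cosh h - \<rho> * sinh h \<le> exp (c * h\<^sup>2 - \<rho> * h)
      \<and> cosh h + \<rho> * sinh h \<le> exp (c * h\<^sup>2 + \<rho> * h)"
    using noisy_step_mgf_le[of \<rho> c] noisy_step_mgf_le[of "-\<rho>" c] c by (simp add: eventually_conj)
  from eventually_compose_filterlim[OF this lim] have "\<forall>\<^sub>F n in sequentially.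
      cosh (l / sqrt n) - \<rho> * sinh (l / sqrt n) \<le> exp (c * (l / sqrt n)\<^sup>2 - \<rho> * (l / sqrt n))
      \<and> cosh (l / sqrt n) + \<rho> * sinh (l / sqrt n) \<le> exp (c * (l / sqrt n)\<^sup>2 + \<rho> * (l / sqrt n))"
    .
  then show ?thesis
    using uniform_tail_asymp[OF less_imp_le[OF tpos]] eventually_gt_at_top[of 0]
  proof eventually_elim
    case (elim n)
    let ?r = "sqrt (real n)"
    let ?h = "l / ?r"
    let ?Y = "{y \<in> cube n. t * ?r \<le> (\<Sum>i<n. real_of_int (y i))}"
    have r: "?r > 0" using elim by simp
    show ?case
    proof
      assume odd: "odd n"
      have hit: "1 - 1 / real k \<le> hit_prob \<rho> n {x. MAJ n x = 1} y" if "y \<in> ?Y" for y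
      proof -
        have y: "y \<in> cube n" "t * ?r \<le> (\<Sum>i<n. real_of_int (y i))" using that by auto
        have "hit_prob \<rho> n {x. (\<Sum>i<n. x i) \<le> 0} y
            \<le> exp (n * c * ?h\<^sup>2 - \<rho> * ?h * (\<Sum>i<n. real_of_int (y i)))"
          using elim(1) l r by (intro sum_string_le_given_center \<rho> y(1)) auto
        also have "\<dots> \<le> exp (n * c * ?h\<^sup>2 - \<rho> * ?h * (t * ?r))"
        proof -
          have "\<rho> * ?h * (t * ?r) \<le> \<rho> * ?h * (\<Sum>i<n. real_of_int (y i))"
            using \<rho> l r by (intro mult_left_mono y(2)) auto
          then show ?thesis by simp
        qed
        also have "n * c * ?h\<^sup>2 - \<rho> * ?h * (t * ?r) = c * l\<^sup>2 - \<rho> * l * t"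
          using r by (simp add: power_divide)
        also have "\<dots> = - (\<rho>\<^sup>2 * t\<^sup>2) / (4 * c)"
          unfolding l_def using c by (simp add: field_simps power2_eq_square)
        also have "\<dots> = - ln k" unfolding t2 using c by simp
        also have "exp (- ln k) = 1 / real k" using k by (simp add: exp_minus inverse_eq_divide)
        finally have "hit_prob \<rho> n {x. (\<Sum>i<n. x i) \<le> 0} y \<le> 1 / real k" .
        moreover have "- {x. (\<Sum>i<n. x i) \<le> 0} = {x. MAJ n x = 1}"
          by (auto simp: MAJ_def sgn_if)
        ultimately show ?thesis
          using hit_prob_compl[OF y(1), of \<rho> "{x. (\<Sum>i<n. x i) \<le> 0}"] by simp
      qed
      have "(1 - 1 / real k) ^ k * (1/2 * exp (- (t\<^sup>2 / 2 + 4 * t + 6)))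
          \<le> (1 - 1 / real k) ^ k * ((1/2)^n * card ?Y)"
        using elim k by (intro mult_left_mono) auto
      also have "\<dots> = (1/2)^n * (\<Sum>y\<in>?Y. \<Prod>v\<in>{1..k}. 1 - 1 / real k)"
        by simp
      also have "\<dots> \<le> (1/2)^n * (\<Sum>y\<in>?Y. \<Prod>v\<in>{1..k}. hit_prob \<rho> n {x. MAJ n x = 1} y)"
        using k hit by (intro mult_left_mono sum_mono prod_mono) auto
      also have "\<dots> \<le> (1/2)^n * (\<Sum>y\<in>cube n. \<Prod>v\<in>{1..k}. hit_prob \<rho> n {x. MAJ n x = 1} y)"
        using \<rho> by (intro mult_left_mono sum_mono2 prod_nonneg) (auto simp: hit_prob_nonneg)
      also have "\<dots> \<le> simple_success_prob (Star k) \<rho> n (star_leaves k) (MAJ n)"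
        unfolding simple_success_prob_def
        using k \<rho> MAJ_cube[OF odd]
        by (subst success_prob_Star_eq)
           (auto intro!: mult_nonneg_nonneg sum_nonneg prod_nonneg zero_le_power hit_prob_nonneg)
      finally show "(1 - 1 / real k) ^ k * (1/2 * exp (- (t\<^sup>2 / 2 + 4 * t + 6)))
          \<le> simple_success_prob (Star k) \<rho> n (star_leaves k) (MAJ n)" .
    qed
  qed
qed

lemma powr_le_exp_ln_sqrt_ln: 
  fixes A e :: real assumes "e > 0" 
  shows "\<forall>\<^sub>F k in sequentially. 1/8 * exp (- (b * ln (real k) + 4 * (A * sqrt (ln (real k))) + 6)) \<ge> real k powr (- b - e)"
proof -
  have "filterlim (\<lambda>k. e * ln (real k) - 4 * (A * sqrt (ln (real k))) - 6 - ln 8) at_top sequentially"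
    using assms by real_asymp
  then have "\<forall>\<^sub>F k in sequentially. e * ln (real k) - 4 * (A * sqrt (ln (real k))) - 6 - ln 8 \<ge> 0"
    unfolding filterlim_at_top by blast
  then show ?thesis using eventually_ge_at_top[of 1]
  proof eventually_elim
    case (elim k)
    have "real k powr (- b - e) = exp ((- b - e) * ln k)" using elim by (simp add: powr_def)
    also have "\<dots> \<le> exp (- (b * ln (real k) + 4 * (A * sqrt (ln (real k))) + 6) - ln 8)"
      using elim by (simp add: algebra_simps)
    also have "\<dots> = 1/8 * exp (- (b * ln (real k) + 4 * (A * sqrt (ln (real k))) + 6))"
      by (simp add: exp_diff)
    finally show ?case .
  qed
qed

text \<open>
  Taking \<open>c\<close> slightly above \<open>(1 - \<rho>\<^sup>2) / 2\<close> makes \<open>t\<^sup>2 / 2 = (\<nu> + \<epsilon>/2) ln k\<close>. The remaining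
  \<open>\<epsilon>/2\<close> absorbs the terms of order \<open>sqrt (ln k)\<close> and the constants.
\<close>

lemma MAJ_lower_bound:
  fixes \<epsilon> \<rho> :: real
  assumes \<rho>: "0 < \<rho>" "\<rho> \<le> 1" and \<epsilon>: "\<epsilon> > 0"
  shows "\<forall>\<^sub>F k in sequentially. \<exists>n0. \<forall>n\<ge>n0. odd n \<longrightarrow>
    real k powr (- star_exponent \<rho> - \<epsilon>) \<le> simple_success_prob (Star k) \<rho> n (star_leaves k) (MAJ n)"
proof -
  define c where "c = (1 - \<rho>\<^sup>2) / 2 + \<epsilon> * \<rho>\<^sup>2 / 4"
  have "\<rho>\<^sup>2 \<le> 1" using \<rho> by (simp add: power_le_one)
  then have c: "c > (1 - \<rho>\<^sup>2) / 2" "c > 0"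
    using \<rho> \<epsilon> by (auto simp: c_def intro!: add_nonneg_pos)
  define A where "A = 2 * sqrt c / \<rho>"
  have A2: "A\<^sup>2 / 2 = star_exponent \<rho> + \<epsilon> / 2"
    using c \<rho> by (simp add: A_def power_mult_distrib power_divide star_exponent_def c_def field_simps)
  have "\<forall>\<^sub>F k in sequentially. (1 - 1 / real k) ^ k \<ge> 1 / 4"
  proof -
    have "((\<lambda>k. (1 - 1 / real k) ^ k) \<longlongrightarrow> exp (- 1)) sequentially" by real_asymp
    moreover have "exp (- 1 :: real) > 1 / 4"
      using exp_le by (simp add: exp_minus field_simps)
    ultimately have "\<forall>\<^sub>F k in sequentially. (1 - 1 / real k) ^ k > 1 / 4" by (rule order_tendstoD)
    then show ?thesis by (rule eventually_mono) simp
  qed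
  then show ?thesis
    using powr_le_exp_ln_sqrt_ln[OF half_gt_zero[OF \<epsilon>], of "star_exponent \<rho> + \<epsilon> / 2" A] eventually_ge_at_top[of 2]
  proof eventually_elim
    case (elim k)
    define t where "t = A * sqrt (ln (real k))"
    have t2: "t\<^sup>2 / 2 = (star_exponent \<rho> + \<epsilon> / 2) * ln k"
      using elim by (simp add: t_def power_mult_distrib A2[symmetric])
    have "real k powr (- star_exponent \<rho> - \<epsilon>) = real k powr (- (star_exponent \<rho> + \<epsilon> / 2) - \<epsilon> / 2)"
      by (rule arg_cong[where f = "\<lambda>e. real k powr e"]) simp
    also have "\<dots> \<le> 1/8 * exp (- (t\<^sup>2 / 2 + 4 * t + 6))"
      using elim(2) unfolding t2 by (simp add: t_def)
    also have "\<dots> \<le> (1 - 1 / real k) ^ k * (1/2 * exp (- (t\<^sup>2 / 2 + 4 * t + 6)))"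
      using elim(1) by simp
    finally have le: "real k powr (- star_exponent \<rho> - \<epsilon>)
        \<le> (1 - 1 / real k) ^ k * (1/2 * exp (- (t\<^sup>2 / 2 + 4 * t + 6)))" .
    from MAJ_success_ge[OF \<rho> c, of k t] elim(3) obtain n0 where
      "\<And>n. n \<ge> n0 \<Longrightarrow> odd n \<Longrightarrow> (1 - 1 / real k) ^ k * (1/2 * exp (- (t\<^sup>2 / 2 + 4 * t + 6)))
        \<le> simple_success_prob (Star k) \<rho> n (star_leaves k) (MAJ n)"
      by (auto simp: t_def A_def eventually_sequentially)
    then show ?case using le order_trans by blast
  qed
qed

section \<open>The asymptotic statement\<close>

text \<open>
  The usual diagonal argument: \<open>\<eta> k = 1 / (j + 1)\<close> for the largest \<open>j \<le> k\<close> whose threshold \<open>N j\<close> has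
  been passed by \<open>k\<close>.
\<close>

lemma diagonal_error_sequence:
  fixes Q :: "real \<Rightarrow> nat \<Rightarrow> bool"
  assumes "\<And>\<epsilon>. \<epsilon> > 0 \<Longrightarrow> \<forall>\<^sub>F k in sequentially. Q \<epsilon> k"
  shows "\<exists>\<eta>. (\<forall>k. \<eta> k \<ge> 0) \<and> \<eta> \<longlonglongrightarrow> 0 \<and> (\<forall>\<^sub>F k in sequentially. Q (\<eta> k) k)"
proof -
  have "\<exists>N. \<forall>k\<ge>N. Q (1 / real (Suc j)) k" for j
    using assms[of "1 / real (Suc j)"] by (simp add: eventually_sequentially)
  then obtain N where N: "\<And>j k. k \<ge> N j \<Longrightarrow> Q (1 / real (Suc j)) k" by metis
  define J where "J k = {j. j \<le> k \<and> N j \<le> k}" for k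
  define g where "g k = Max (J k)" for k
  have fin: "finite (J k)" for k
    unfolding J_def by (rule finite_subset[of _ "{..k}"]) auto
  have ge: "j \<le> g k" if "k \<ge> max j (N j)" for j k
    unfolding g_def using that by (intro Max_ge fin) (auto simp: J_def)
  have good: "Q (1 / real (Suc (g k))) k" if "k \<ge> N 0" for k
  proof (rule N)
    have "0 \<in> J k" using that by (auto simp: J_def)
    then have "g k \<in> J k" unfolding g_def by (intro Max_in fin) auto
    then show "N (g k) \<le> k" by (simp add: J_def)
  qed
  have "filterlim g at_top sequentially"
    unfolding filterlim_at_top eventually_sequentially using ge by blast
  then have "(\<lambda>k. 1 / real (Suc (g k))) \<longlonglongrightarrow> 0"
    by (rule filterlim_compose[OF LIMSEQ_Suc[OF lim_const_over_n]])
  moreover have "\<forall>\<^sub>F k in sequentially. Q (1 / real (Suc (g k))) k"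
    using good unfolding eventually_sequentially by blast
  ultimately show ?thesis
    by (intro exI[of _ "\<lambda>k. 1 / real (Suc (g k))"]) auto
qed

theorem theorem4p1:
  fixes \<rho> :: real
  assumes "0 < \<rho>" and "\<rho> \<le> 1"
  shows "\<exists>\<eta> :: nat \<Rightarrow> real.
    (\<forall>k. \<eta> k \<ge> 0) \<and> \<eta> \<longlonglongrightarrow> 0 \<and>
    (\<forall>\<^sub>F k in sequentially.
       real k powr (- star_exponent \<rho> - \<eta> k) \<le> max_success (Star k) \<rho> (star_leaves k) \<and>
       max_success (Star k) \<rho> (star_leaves k) \<le> real k powr (- star_exponent \<rho> + \<eta> k)) \<and>
    (\<forall>\<^sub>F k in sequentially. \<exists>n0. \<forall>n\<ge>n0. odd n \<longrightarrow>
       simple_success_prob (Star k) \<rho> n (star_leaves k) (MAJ n)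
         \<ge> real k powr (- star_exponent \<rho> - \<eta> k))"
proof -
  let ?L = "\<lambda>\<epsilon> k. \<exists>n0. \<forall>n\<ge>n0. odd n \<longrightarrow> real k powr (- star_exponent \<rho> - \<epsilon>)
      \<le> simple_success_prob (Star k) \<rho> n (star_leaves k) (MAJ n)"
  let ?U = "\<lambda>\<epsilon> k. max_success (Star k) \<rho> (star_leaves k) \<le> real k powr (- star_exponent \<rho> + \<epsilon>)"
  have "\<forall>\<^sub>F k in sequentially. ?L \<epsilon> k \<and> ?U \<epsilon> k" if "\<epsilon> > 0" for \<epsilon>
    using MAJ_lower_bound[OF assms that] max_success_upper_bound[OF assms that]
    by (rule eventually_conj)
  from diagonal_error_sequence[of "\<lambda>\<epsilon> k. ?L \<epsilon> k \<and> ?U \<epsilon> k", OF this]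
  obtain \<eta> where \<eta>: "\<forall>k. \<eta> k \<ge> 0" "\<eta> \<longlonglongrightarrow> 0" "\<forall>\<^sub>F k in sequentially. ?L (\<eta> k) k \<and> ?U (\<eta> k) k"
    by blast
  have max: "real k powr (- star_exponent \<rho> - \<epsilon>) \<le> max_success (Star k) \<rho> (star_leaves k)"
    if "?L \<epsilon> k" for k \<epsilon>
  proof -
    obtain n0 where n0: "\<And>n. n \<ge> n0 \<Longrightarrow> odd n \<Longrightarrow> real k powr (- star_exponent \<rho> - \<epsilon>)
      \<le> simple_success_prob (Star k) \<rho> n (star_leaves k) (MAJ n)" using \<open>?L \<epsilon> k\<close> by blast
    have "real k powr (- star_exponent \<rho> - \<epsilon>)
      \<le> simple_success_prob (Star k) \<rho> (2 * n0 + 1) (star_leaves k) (MAJ (2 * n0 + 1))"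
      by (rule n0) auto
    also have "\<dots> \<le> max_success (Star k) \<rho> (star_leaves k)"
      using assms by (intro max_success_Star_ge_MAJ) auto
    finally show ?thesis .
  qed
  show ?thesis
    using \<eta> by (intro exI[of _ \<eta>] conjI) (auto elim!: eventually_mono intro: max)
qed

end
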